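(* Let $p$ be a prime number, let $s$ be a positive divisor of $p-1$, and let $\mathbb{K}$ be the unique subfield of $\mathbb{Q}(\zeta_p)$ with $[\mathbb{K}:\mathbb{Q}]=s$. Let $\mathcal{M}_p\subseteq\mathcal{O}_{\mathbb{K}}$ be the $\mathbb{Z}$-submodule defined in the context. Then $$[\mathcal{O}_{\mathbb{K}}:\mathcal{M}_p]=\begin{cases} p^{\frac{s+1}{2}} & \text{if } s\equiv 1\pmod 2,\\ p^{\frac{s+2}{2}} & \text{if } s\equiv 0\pmod 2.\end{cases}$$
   Context: Here $\zeta_p$ is a primitive $p$-th root of unity, $\mathbb{L}=\mathbb{Q}(\zeta_p)$, and $\mathcal{O}_{\mathbb{K}}$ is the ring of algebraic integers of $\mathbb{K}$. Let $u$ be an integer whose class generates $(\mathbb{Z}/p\mathbb{Z})^{\star}$, let $\sigma_u$ be the automorphism of $\mathbb{L}$ with $\sigma_u(\zeta_p)=\zeta_p^u$, let $\theta=\sigma_u|_{\mathbb{K}}$ (a generator of $\mathrm{Gal}(\mathbb{K}/\mathbb{Q})$), and let $t=\mathrm{Tr}_{\mathbb{L}/\mathbb{K}}(\zeta_p)$. The map $(a_0,\ldots,a_{s-1})\mapsto\sum_{i=0}^{s-1}a_i\theta^i(t)$ is an isomorphism of $\mathbb{Z}$-modules $\mathbb{Z}^s\to\mathcal{O}_{\mathbb{K}}$, and through it elements ${\bf x}\in\mathcal{O}_{\mathbb{K}}$ are identified with their coordinate vectors ${\bf x}=(a_0,\ldots,a_{s-1})\in\mathbb{Z}^s$. Let $\beta\in\mathbb{Z}$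 be a primitive root modulo $p$ (of multiplicative order $p-1$ modulo $p$), and put $\alpha=\beta^{(p-1)/s}$. For $i=0,1,\ldots,s-1$ let $\mu_i=(1,\alpha^i,\alpha^{2i},\ldots,\alpha^{(s-1)i})\in\mathbb{Z}^s$, and let $\cdot$ denote the usual dot product on $\mathbb{Z}^s$. Define: if $s$ is odd, $\mathcal{M}_p=\{{\bf x}\in\mathcal{O}_{\mathbb{K}}:{\bf x}\cdot\mu_i\equiv 0\pmod p\text{ for all } i=0,1,\ldots,\frac{s-1}{2}\}$; if $s$ is even, $\mathcal{M}_p=\{{\bf x}\in\mathcal{O}_{\mathbb{K}}:{\bf x}\cdot\mu_i\equiv 0\pmod p\text{ for all } i=0,1,\ldots,\frac{s}{2}\}$. *)

theory Defs
  imports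
    "HOL-Algebra.Algebra"
    "HOL-Number_Theory.Number_Theory"
    "Jordan_Normal_Form.VS_Connect"
begin

text \<open>
  Number fields are subsets of the complex numbers; \<^term>\<open>class_ring\<close> is the field of complex
  numbers as a HOL-Algebra record. Coordinate vectors are integer vectors in
  \<^term>\<open>carrier_vec s\<close>, indexed from 0 to \<open>s - 1\<close>.
\<close>

definition primitive_root_of_unity :: "nat \<Rightarrow> complex \<Rightarrow> bool" where
  "primitive_root_of_unity n z \<longleftrightarrow> z ^ n = 1 \<and> (\<forall>k. 0 < k \<and> k < n \<longrightarrow> z ^ k \<noteq> 1)"

definition rat_adjoin :: "complex \<Rightarrow> complex set" where
  "rat_adjoin z = generate_field class_ring (insert z \<rat>)"

definition subring_of_complex :: "complex set \<Rightarrow> complex ring" where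
  "subring_of_complex A = class_ring\<lparr>carrier := A\<rparr>"

definition algebraic_integers :: "complex set \<Rightarrow> complex set" where
  "algebraic_integers K = {x \<in> K. algebraic_int x}"

definition field_automorphisms :: "complex set \<Rightarrow> (complex \<Rightarrow> complex) set" where
  "field_automorphisms L = ring_iso (subring_of_complex L) (subring_of_complex L)"

text \<open>
  Automorphisms are total functions in HOL; restricting to \<^const>\<open>extensional\<close> ones makes
  each automorphism of \<open>L\<close> occur exactly once, so that the sum in \<open>galois_trace\<close> is over the
  finite group \<open>Gal(L/K)\<close>. This is the trace for Galois extensions \<open>L/K\<close>.
\<close>

definition galois_group :: "complex set \<Rightarrow> complex set \<Rightarrow> (complex \<Rightarrow> complex) set" where
  "galois_group L K = {\<tau> \<in> field_automorphisms L \<inter> extensional L. \<forall>x\<in>K. \<tau> x = x}"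

definition galois_trace :: "complex set \<Rightarrow> complex set \<Rightarrow> complex \<Rightarrow> complex" where
  "galois_trace L K x = (\<Sum>\<tau>\<in>galois_group L K. \<tau> x)"

definition conj_comb :: "nat \<Rightarrow> (complex \<Rightarrow> complex) \<Rightarrow> complex \<Rightarrow> int vec \<Rightarrow> complex" where
  "conj_comb s \<theta> t a = (\<Sum>i<s. of_int (a $ i) * (\<theta> ^^ i) t)"

definition coords :: "nat \<Rightarrow> (complex \<Rightarrow> complex) \<Rightarrow> complex \<Rightarrow> complex \<Rightarrow> int vec" where
  "coords s \<theta> t = the_inv_into (carrier_vec s) (conj_comb s \<theta> t)"

definition mu :: "nat \<Rightarrow> int \<Rightarrow> nat \<Rightarrow> int vec" where
  "mu s \<alpha> i = vec s (\<lambda>j. \<alpha> ^ (j * i))"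

definition M_lattice ::
    "nat \<Rightarrow> nat \<Rightarrow> complex set \<Rightarrow> (complex \<Rightarrow> complex) \<Rightarrow> complex \<Rightarrow> int \<Rightarrow> complex set" where
  "M_lattice p s K \<theta> t \<alpha> =
     {x \<in> algebraic_integers K.
        \<forall>i \<in> {0..(if odd s then (s - 1) div 2 else s div 2)}.
          [coords s \<theta> t x \<bullet> mu s \<alpha> i = 0] (mod int p)}"

definition generates_units_mod :: "nat \<Rightarrow> int \<Rightarrow> bool" where
  "generates_units_mod p u \<longleftrightarrow>
     u mod int p \<in> carrier (units_of (residue_ring (int p))) \<and>
     generate (units_of (residue_ring (int p))) {u mod int p}
       = carrier (units_of (residue_ring (int p)))"

definition additive_index :: "complex set \<Rightarrow> complex set \<Rightarrow> nat" where
  "additive_index A B = card (a_rcosets\<^bsub>subring_of_complex A\<^esub> B)"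

end

theory Submission
  imports Defs "Jordan_Normal_Form.Char_Poly"
    "HOL-Computational_Algebra.Fundamental_Theorem_Algebra"
begin

text \<open>
  The conjugates \<open>\<sigma>^k(\<zeta>)\<close>, \<open>k < p - 1\<close>, form a \<open>\<rat>\<close>-basis of \<open>\<rat>(\<zeta>)\<close>. The coordinates of an algebraic
  integer lie in \<open>(1/p)\<int>\<close> by the trace form, and in \<open>\<int>\<close> because \<open>p\<close> equals \<open>(1 - \<zeta>)^(p - 1)\<close> up
  to a unit. If \<open>d\<close> is the least positive exponent with \<open>\<sigma>^d\<close> the identity on \<open>K\<close>, then the minimal
  polynomial of a \<open>p\<close>-th root of unity over \<open>K\<close> has exactly its \<open>\<sigma>^d\<close>-conjugates as roots, so the
  Gaussian periods lie in \<open>K\<close>; comparing coordinates, they form a \<open>\<rat>\<close>-basis of \<open>K\<close> and a \<open>\<int>\<close>-basis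
  of its ring of integers, and hence \<open>d = s\<close>. In these coordinates the submodule is the kernel of a map
  \<open>\<int>^s \<rightarrow> (\<int>/p)^m\<close> given by the first \<open>m \<le> s\<close> rows of the Fourier matrix of \<open>\<alpha>\<close>, which has order \<open>s\<close>
  modulo \<open>p\<close>; the matrix is invertible modulo \<open>p\<close>, so the map is surjective and the index is \<open>p^m\<close>.
\<close>

section \<open>Algebraic integers form a ring\<close>

text \<open>The relations make \<open>x\<close> an eigenvalue of the integer matrix \<open>A\<close>
  with eigenvector \<open>v\<close>, hence a root of a monic characteristic polynomial with integer
  coefficients. The \<open>v i\<close> may be dependent; only the zero vector is excluded.\<close>

lemma algebraic_int_if_stable_span:
  fixes x :: complex and v :: "'i \<Rightarrow> complex"
  assumes fin: "finite I" and nz: "\<exists>i\<in>I. v i \<noteq> 0"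
    and stable: "\<And>i. i \<in> I \<Longrightarrow> x * v i = (\<Sum>j\<in>I. of_int (A i j) * v j)"
  shows "algebraic_int x"
proof -
  define n where "n = card I"
  obtain h where h: "bij_betw h {..<n} I"
    using ex_bij_betw_nat_finite[OF fin] by (auto simp: n_def atLeast0LessThan)
  define M where "M = mat n n (\<lambda>(i, j). A (h i) (h j))"
  define N :: "complex mat" where "N = map_mat of_int M"
  define w where "w = vec n (\<lambda>i. v (h i))"
  have M: "M \<in> carrier_mat n n" and N: "N \<in> carrier_mat n n" by (auto simp: M_def N_def)
  have "N *\<^sub>v w = x \<cdot>\<^sub>v w"
  proof (rule eq_vecI)
    fix i assume "i < dim_vec (x \<cdot>\<^sub>v w)"
    hence i: "i < n" by (simp add: w_def)
    have "(N *\<^sub>v w) $ i = (\<Sum>j<n. of_int (A (h i) (h j)) * v (h j))"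
      using i by (auto simp: N_def M_def w_def scalar_prod_def atLeast0LessThan intro!: sum.cong)
    also have "\<dots> = (\<Sum>j\<in>I. of_int (A (h i) j) * v j)"
      by (rule sum.reindex_bij_betw[OF h])
    also have "\<dots> = x * v (h i)"
      using stable[of "h i"] bij_betwE[OF h] i by auto
    finally show "(N *\<^sub>v w) $ i = (x \<cdot>\<^sub>v w) $ i" using i by (simp add: w_def)
  qed (simp add: N_def M_def w_def)
  moreover have "w \<noteq> 0\<^sub>v n"
  proof
    assume "w = 0\<^sub>v n"
    hence "w $ i = 0" if "i < n" for i using that by simp
    hence "v (h i) = 0" if "i < n" for i using that by (simp add: w_def)
    with nz h show False by (auto simp: bij_betw_def)
  qed
  ultimately have "eigenvalue N x"
    using N unfolding eigenvalue_def eigenvector_def by (auto intro!: exI[of _ w] simp: w_def)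
  hence "poly (char_poly N) x = 0" using eigenvalue_root_char_poly[OF N] by simp
  hence "poly (map_poly of_int (char_poly M)) x = 0"
    using of_int_hom.char_poly_hom[OF M, where 'a = complex] by (simp add: N_def)
  moreover have "Polynomial.lead_coeff (char_poly M) = 1"
    using degree_monic_char_poly[OF M] by simp
  ultimately show ?thesis unfolding algebraic_int_altdef_ipoly by blast
qed

lemma algebraic_int_power_reduce:
  fixes x :: complex
  assumes "algebraic_int x"
  obtains n and a :: "nat \<Rightarrow> int" where "n > 0" "x ^ n = (\<Sum>i<n. of_int (a i) * x ^ i)"
proof -
  obtain P where P: "poly (map_poly of_int P) x = 0" "Polynomial.lead_coeff P = 1"
    using assms unfolding algebraic_int_altdef_ipoly by blast
  let ?n = "Polynomial.degree P"
  have "Polynomial.degree (map_poly (of_int :: int \<Rightarrow> complex) P) = ?n"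
    by (simp add: degree_map_poly)
  hence "0 = (\<Sum>i\<le>?n. of_int (Polynomial.coeff P i) * x ^ i)"
    using P(1) by (simp add: poly_altdef coeff_map_poly)
  also have "\<dots> = (\<Sum>i<?n. of_int (Polynomial.coeff P i) * x ^ i) + x ^ ?n"
    using P(2) by (simp add: lessThan_Suc_atMost[symmetric])
  finally have *: "x ^ ?n = (\<Sum>i<?n. of_int (- Polynomial.coeff P i) * x ^ i)"
    by (simp add: sum_negf add_eq_0_iff)
  moreover have "?n > 0"
  proof (rule ccontr)
    assume "\<not> ?n > 0"
    with * show False by simp
  qed
  ultimately show ?thesis using that[of ?n "\<lambda>i. - Polynomial.coeff P i"] by blast
qed

text \<open>The products \<open>x ^ i * y ^ j\<close> with \<open>i < n\<close> and
  \<open>j < m\<close> span a module stable under multiplication by \<open>x\<close> and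
  \<open>y\<close>, hence by \<open>z\<close>. The shape of \<open>z\<close> covers sums,
  differences and products at once.\<close>

lemma algebraic_int_bivariate:
  fixes x y z :: complex
  assumes "algebraic_int x" "algebraic_int y"
    and z: "z = of_int a * x + of_int b * y + of_int c * (x * y)"
  shows "algebraic_int z"
proof -
  obtain n f where n: "n > 0" "x ^ n = (\<Sum>i<n. of_int (f i) * x ^ i)"
    using algebraic_int_power_reduce[OF assms(1)] by metis
  obtain m g where m: "m > 0" "y ^ m = (\<Sum>i<m. of_int (g i) * y ^ i)"
    using algebraic_int_power_reduce[OF assms(2)] by metis
  \<comment> \<open>Companion matrices: multiplication by \<open>x\<close> shifts the powers, and
    the last row holds the coefficients of \<open>x ^ n\<close>; likewise \<open>e'\<close> for
    \<open>y\<close>.\<close>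
  define e :: "nat \<Rightarrow> nat \<Rightarrow> int" where
    "e = (\<lambda>i k. if Suc i < n then of_bool (k = Suc i) else f k)"
  define e' :: "nat \<Rightarrow> nat \<Rightarrow> int" where
    "e' = (\<lambda>j l. if Suc j < m then of_bool (l = Suc j) else g l)"
  have e: "x * x ^ i = (\<Sum>k<n. of_int (e i k) * x ^ k)" if "i < n" for i
  proof (cases "Suc i < n")
    case False
    with that have "Suc i = n" by simp
    hence "x * x ^ i = x ^ n" by (metis power_Suc)
    with n(2) False show ?thesis by (simp add: e_def)
  qed (simp add: e_def of_bool_def if_distrib[of of_int] if_distrib[of "\<lambda>u. u * _"] cong: if_cong)
  have e': "y * y ^ j = (\<Sum>l<m. of_int (e' j l) * y ^ l)" if "j < m" for j
  proof (cases "Suc j < m")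
    case False
    with that have "Suc j = m" by simp
    hence "y * y ^ j = y ^ m" by (metis power_Suc)
    with m(2) False show ?thesis by (simp add: e'_def)
  qed (simp add: e'_def of_bool_def if_distrib[of of_int] if_distrib[of "\<lambda>u. u * _"] cong: if_cong)
  define I where "I = {..<n} \<times> {..<m}"
  define v where "v = (\<lambda>ij :: nat \<times> nat. x ^ fst ij * y ^ snd ij)"
  \<comment> \<open>A combination of Kronecker products: \<open>x\<close> acts on the first index,
    \<open>y\<close> on the second, \<open>x * y\<close> on both.\<close>
  define A where "A = (\<lambda>(i, j) (k, l).
     a * (e i k * of_bool (l = j)) + b * (of_bool (k = i) * e' j l) + c * (e i k * e' j l))"
  show ?thesis
  proof (rule algebraic_int_if_stable_span[of I v z A])
    show "finite I" by (simp add: I_def)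
    show "\<exists>i\<in>I. v i \<noteq> 0" using n(1) m(1) by (intro bexI[of _ "(0, 0)"]) (auto simp: I_def v_def)
    fix ij assume "ij \<in> I"
    then obtain i j where ij: "ij = (i, j)" "i < n" "j < m" by (auto simp: I_def)
    define U where "U = (\<Sum>k<n. of_int (e i k) * x ^ k)"
    define W where "W = (\<Sum>l<m. of_int (e' j l) * y ^ l)"
    have x: "x ^ i = (\<Sum>k<n. of_int (of_bool (k = i)) * x ^ k)"
      using ij by (simp add: of_bool_def if_distrib[of of_int] if_distrib[of "\<lambda>u. u * _"] cong: if_cong)
    have y: "y ^ j = (\<Sum>l<m. of_int (of_bool (l = j)) * y ^ l)"
      using ij by (simp add: of_bool_def if_distrib[of of_int] if_distrib[of "\<lambda>u. u * _"] cong: if_cong)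
    have "z * v ij = of_int a * ((x * x ^ i) * y ^ j) + of_int b * (x ^ i * (y * y ^ j))
        + of_int c * ((x * x ^ i) * (y * y ^ j))"
      by (simp add: z v_def ij algebra_simps)
    also have "\<dots> = of_int a * (U * y ^ j) + of_int b * (x ^ i * W) + of_int c * (U * W)"
      unfolding e[OF ij(2)] e'[OF ij(3)] U_def W_def ..
    also have "U * y ^ j = (\<Sum>k<n. \<Sum>l<m. of_int (e i k * of_bool (l = j)) * (x ^ k * y ^ l))"
      unfolding U_def y sum_product by (intro sum.cong refl) (simp add: mult_ac)
    also have "x ^ i * W = (\<Sum>k<n. \<Sum>l<m. of_int (of_bool (k = i) * e' j l) * (x ^ k * y ^ l))"
      unfolding W_def x sum_product by (intro sum.cong refl) (simp add: mult_ac)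
    also have "U * W = (\<Sum>k<n. \<Sum>l<m. of_int (e i k * e' j l) * (x ^ k * y ^ l))"
      unfolding U_def W_def sum_product by (intro sum.cong refl) (simp add: mult_ac)
    also have "of_int a * (\<Sum>k<n. \<Sum>l<m. of_int (e i k * of_bool (l = j)) * (x ^ k * y ^ l))
        + of_int b * (\<Sum>k<n. \<Sum>l<m. of_int (of_bool (k = i) * e' j l) * (x ^ k * y ^ l))
        + of_int c * (\<Sum>k<n. \<Sum>l<m. of_int (e i k * e' j l) * (x ^ k * y ^ l))
        = (\<Sum>k<n. \<Sum>l<m. of_int (A (i, j) (k, l)) * (x ^ k * y ^ l))"
      unfolding sum_distrib_left sum.distrib[symmetric]
      by (intro sum.cong refl) (simp only: A_def prod.case of_int_add of_int_mult algebra_simps)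
    also have "\<dots> = (\<Sum>kl\<in>I. of_int (A ij kl) * v kl)"
      by (simp add: I_def sum.cartesian_product v_def ij case_prod_unfold)
    finally show "z * v ij = (\<Sum>kl\<in>I. of_int (A ij kl) * v kl)" .
  qed
qed

lemma algebraic_int_add:
  fixes x y :: complex
  shows "algebraic_int x \<Longrightarrow> algebraic_int y \<Longrightarrow> algebraic_int (x + y)"
  by (rule algebraic_int_bivariate[of x y _ 1 1 0]) auto

lemma algebraic_int_mult:
  fixes x y :: complex
  shows "algebraic_int x \<Longrightarrow> algebraic_int y \<Longrightarrow> algebraic_int (x * y)"
  by (rule algebraic_int_bivariate[of x y _ 0 0 1]) auto

lemma algebraic_int_diff:
  fixes x y :: complex
  shows "algebraic_int x \<Longrightarrow> algebraic_int y \<Longrightarrow> algebraic_int (x - y)"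
  by (rule algebraic_int_bivariate[of x y _ 1 "-1" 0]) auto

lemma algebraic_int_sum:
  fixes f :: "'i \<Rightarrow> complex"
  shows "(\<And>i. i \<in> A \<Longrightarrow> algebraic_int (f i)) \<Longrightarrow> algebraic_int (\<Sum>i\<in>A. f i)"
  by (induction A rule: infinite_finite_induct) (auto intro: algebraic_int_add)

lemma algebraic_int_prod:
  fixes f :: "'i \<Rightarrow> complex"
  shows "(\<And>i. i \<in> A \<Longrightarrow> algebraic_int (f i)) \<Longrightarrow> algebraic_int (\<Prod>i\<in>A. f i)"
  by (induction A rule: infinite_finite_induct) (auto intro: algebraic_int_mult)

lemma algebraic_int_power:
  fixes x :: complex
  shows "algebraic_int x \<Longrightarrow> algebraic_int (x ^ n)"
  by (induction n) (auto intro: algebraic_int_mult)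

section \<open>Prime roots of unity\<close>

text \<open>Both sides are monic of degree \<open>card A\<close> and agree on \<open>A\<close>; the
  leading terms cancel in the difference, which then has too many roots to be nonzero.\<close>

lemma monic_poly_eq_prod_roots:
  fixes q :: "complex poly"
  assumes "Polynomial.lead_coeff q = 1" "card A = Polynomial.degree q"
    and "\<And>a. a \<in> A \<Longrightarrow> poly q a = 0"
  shows "q = (\<Prod>a\<in>A. [:- a, 1:])"
proof -
  have fin: "finite A"
  proof -
    have "q \<noteq> 0" using assms(1) by auto
    moreover have "A \<subseteq> {a. poly q a = 0}" using assms(3) by blast
    ultimately show "finite A" using poly_roots_finite finite_subset by blast
  qed
  have deg: "Polynomial.degree (\<Prod>a\<in>A. [:- a, 1:]) = card A"
    using fin by (simp add: degree_prod_sum_eq)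
  have monic: "Polynomial.lead_coeff (\<Prod>a\<in>A. [:- a, 1:]) = 1"
    by (rule monic_prod) simp
  show ?thesis
  proof (rule poly_eqI_degree_lead_coeff[of q "card A" _ A])
    show "Polynomial.coeff q (card A) = Polynomial.coeff (\<Prod>a\<in>A. [:- a, 1:]) (card A)"
      using assms(1) monic unfolding deg assms(2) by (rule trans[OF _ sym])
    show "poly q x = poly (\<Prod>a\<in>A. [:- a, 1:]) x" if "x \<in> A" for x
      using that fin assms(3) by (simp add: poly_prod prod_zero_iff)
  qed (simp_all only: deg assms(2) order_refl)
qed

locale prime_root_of_unity =
  fixes p :: nat and \<zeta> :: complex
  assumes prime_p: "Factorial_Ring.prime p" and primitive: "primitive_root_of_unity p \<zeta>"
begin

lemma p_gt_1: "p > 1" and zeta_power_p: "\<zeta> ^ p = 1" and zeta_nonzero: "\<zeta> \<noteq> 0"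
proof -
  show p: "p > 1" using prime_p prime_gt_1_nat by blast
  show "\<zeta> ^ p = 1" using primitive by (simp add: primitive_root_of_unity_def)
  with p show "\<zeta> \<noteq> 0" by (auto simp: power_0_left)
qed

lemma zeta_power_mod: "\<zeta> ^ (m mod p) = \<zeta> ^ m"
proof -
  have "\<zeta> ^ m = \<zeta> ^ (p * (m div p) + m mod p)" by simp
  also have "\<dots> = \<zeta> ^ (m mod p)" by (simp only: power_add power_mult) (simp add: zeta_power_p)
  finally show ?thesis by simp
qed

lemma zeta_power_eq_1_iff: "\<zeta> ^ m = 1 \<longleftrightarrow> p dvd m"
proof
  assume "\<zeta> ^ m = 1"
  hence "\<zeta> ^ (m mod p) = 1" by (simp add: zeta_power_mod)
  moreover have "m mod p < p" using p_gt_1 by simp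
  moreover have "\<zeta> ^ k \<noteq> 1" if "0 < k" "k < p" for k
    using primitive that by (simp add: primitive_root_of_unity_def)
  ultimately show "p dvd m" by (metis dvd_eq_mod_eq_0 gr0I)
next
  assume "p dvd m"
  thus "\<zeta> ^ m = 1" by (metis zeta_power_mod dvd_imp_mod_0 power_0)
qed

lemma zeta_power_eq_iff: "\<zeta> ^ m = \<zeta> ^ n \<longleftrightarrow> [m = n] (mod p)"
proof (induction m n rule: linorder_wlog)
  case (le m n)
  have "\<zeta> ^ m = \<zeta> ^ n \<longleftrightarrow> \<zeta> ^ m * \<zeta> ^ (n - m) = \<zeta> ^ m * 1"
    using le by (simp add: power_add [symmetric] eq_commute)
  also have "\<dots> \<longleftrightarrow> p dvd n - m"
    using zeta_nonzero by (simp only: mult_cancel_left zeta_power_eq_1_iff) simp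
  also have "\<dots> \<longleftrightarrow> [m = n] (mod p)" using le by (simp add: cong_altdef_nat cong_sym_eq[of m n])
  finally show ?case .
next
  case (sym n m)
  thus ?case by (metis cong_sym_eq)
qed

lemma inj_zeta_power: "inj_on (\<lambda>m. \<zeta> ^ m) {..<p}"
  by (auto simp: inj_on_def zeta_power_eq_iff cong_def)

lemma algebraic_int_zeta: "algebraic_int \<zeta>"
  by (rule algebraic_int_root[of 1 "Polynomial.monom 1 p"])
    (use p_gt_1 in \<open>auto simp: poly_monom zeta_power_p Polynomial.degree_monom_eq\<close>)

lemma sum_zeta_powers:
  assumes "\<not> p dvd m"
  shows "(\<Sum>j\<in>{1..<p}. \<zeta> ^ (m * j)) = - 1"
proof -
  have "(\<zeta> ^ m - 1) * (\<Sum>j<p. (\<zeta> ^ m) ^ j) = (\<zeta> ^ m) ^ p - 1"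
    by (rule power_diff_1_eq [symmetric])
  also have "\<dots> = 0" by (metis power_commutes power_mult mult.commute power_one zeta_power_p diff_self)
  finally have "(\<Sum>j<p. \<zeta> ^ (m * j)) = 0" using assms by (simp add: zeta_power_eq_1_iff power_mult)
  moreover have "{..<p} = insert 0 {1..<p}" using p_gt_1 by auto
  ultimately show ?thesis by (simp add: add_eq_0_iff)
qed

section \<open>The prime p as a power of 1 - \<zeta> up to a unit\<close>

lemma prod_one_minus_zeta_powers: "(\<Prod>j\<in>{1..<p}. 1 - \<zeta> ^ j) = of_nat p"
proof -
  \<comment> \<open>\<open>q\<close> is 1 + X + ... + X^(p - 1). Its roots are the nontrivial powers
    of \<zeta>, so its value at 1, which is \<open>p\<close>, is the product in question.\<close>
  define q :: "complex poly" where "q = (\<Sum>i<p. Polynomial.monom 1 i)"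
  have coeff_q: "Polynomial.coeff q i = of_bool (i < p)" for i
    by (simp add: q_def Polynomial.coeff_sum of_bool_def)
  have deg: "Polynomial.degree q = p - 1"
  proof (rule antisym)
    show "Polynomial.degree q \<le> p - 1" by (rule Polynomial.degree_le) (auto simp: coeff_q)
    show "p - 1 \<le> Polynomial.degree q" by (rule Polynomial.le_degree) (use p_gt_1 in \<open>auto simp: coeff_q\<close>)
  qed
  have inj: "inj_on (\<lambda>m. \<zeta> ^ m) {1..<p}" by (rule inj_on_subset[OF inj_zeta_power]) auto
  have "q = (\<Prod>a\<in>(\<lambda>j. \<zeta> ^ j) ` {1..<p}. [:- a, 1:])"
  proof (rule monic_poly_eq_prod_roots)
    show "Polynomial.lead_coeff q = 1" using p_gt_1 by (simp add: deg coeff_q)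
    show "card ((\<lambda>j. \<zeta> ^ j) ` {1..<p}) = Polynomial.degree q"
      unfolding card_image[OF inj] deg by simp
    fix a assume "a \<in> (\<lambda>j. \<zeta> ^ j) ` {1..<p}"
    then obtain j where j: "a = \<zeta> ^ j" "j \<in> {1..<p}" by blast
    have "poly q a = (\<Sum>i<p. a ^ i)" by (simp add: q_def poly_sum poly_monom)
    moreover have "(a - 1) * (\<Sum>i<p. a ^ i) = a ^ p - 1" by (rule power_diff_1_eq [symmetric])
    moreover have "a ^ p = 1" unfolding j by (metis mult.commute power_mult power_one zeta_power_p)
    moreover have "a \<noteq> 1" using j by (auto simp: zeta_power_eq_1_iff dest: dvd_imp_le)
    ultimately show "poly q a = 0" by simp
  qed
  hence "poly q 1 = (\<Prod>j\<in>{1..<p}. 1 - \<zeta> ^ j)"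
    by (simp only: poly_prod prod.reindex[OF inj]) simp
  thus ?thesis by (simp add: q_def poly_sum poly_monom)
qed

lemma one_minus_zeta_nonzero: "1 - \<zeta> \<noteq> 0"
  using zeta_power_eq_1_iff[of 1] p_gt_1 by auto

text \<open>Each quotient is a geometric sum. For the second one, \<zeta> is a power of
  \<open>\<zeta> ^ j\<close> because \<open>j\<close> is invertible modulo \<open>p\<close>, so the
  two exchange roles.\<close>

lemma algebraic_int_cyclotomic_unit:
  assumes "j \<in> {1..<p}"
  shows "algebraic_int ((1 - \<zeta> ^ j) / (1 - \<zeta>))" and "algebraic_int ((1 - \<zeta>) / (1 - \<zeta> ^ j))"
proof -
  have *: "algebraic_int ((1 - x ^ k) / (1 - x))" if "x \<noteq> 1" "algebraic_int x" for x :: complex and k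
  proof -
    have "(1 - x ^ k) / (1 - x) = (\<Sum>i<k. x ^ i)"
      using that(1) by (simp add: one_diff_power_eq)
    thus ?thesis using that(2) by (auto intro!: algebraic_int_sum algebraic_int_power)
  qed
  show "algebraic_int ((1 - \<zeta> ^ j) / (1 - \<zeta>))"
    using one_minus_zeta_nonzero algebraic_int_zeta by (intro *) auto
  have "\<not> p dvd j" using assms by (auto dest: dvd_imp_le)
  hence "coprime j p" using prime_imp_coprime[OF prime_p] by (simp add: coprime_commute)
  then obtain k where k: "[j * k = 1] (mod p)" using cong_solve_coprime_nat by auto
  hence "\<zeta> ^ (j * k) = \<zeta> ^ 1" by (subst zeta_power_eq_iff)
  hence "(\<zeta> ^ j) ^ k = \<zeta>" by (simp add: power_mult)
  moreover have "\<zeta> ^ j \<noteq> 1" using assms by (auto simp: zeta_power_eq_1_iff dest: dvd_imp_le)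
  ultimately show "algebraic_int ((1 - \<zeta>) / (1 - \<zeta> ^ j))"
    using *[of "\<zeta> ^ j" k] algebraic_int_power[OF algebraic_int_zeta, of j] by simp
qed

text \<open>Dividing the product formula for \<open>p\<close> factor by factor leaves cyclotomic
  units.\<close>

lemma p_associated:
  "algebraic_int (of_nat p / (1 - \<zeta>) ^ (p - 1))" "algebraic_int ((1 - \<zeta>) ^ (p - 1) / of_nat p)"
proof -
  have "of_nat p / (1 - \<zeta>) ^ (p - 1) = (\<Prod>j\<in>{1..<p}. (1 - \<zeta> ^ j) / (1 - \<zeta>))"
    unfolding prod_dividef prod_one_minus_zeta_powers by simp
  also have "algebraic_int \<dots>" by (intro algebraic_int_prod algebraic_int_cyclotomic_unit(1))
  finally show "algebraic_int (of_nat p / (1 - \<zeta>) ^ (p - 1))" .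
  have "(1 - \<zeta>) ^ (p - 1) / of_nat p = (\<Prod>j\<in>{1..<p}. (1 - \<zeta>) / (1 - \<zeta> ^ j))"
    unfolding prod_dividef prod_one_minus_zeta_powers by simp
  also have "algebraic_int \<dots>" by (intro algebraic_int_prod algebraic_int_cyclotomic_unit(2))
  finally show "algebraic_int ((1 - \<zeta>) ^ (p - 1) / of_nat p)" .
qed

text \<open>Among algebraic integers \<open>a ^ (p - 1)\<close> is divisible by
  \<open>(1 - \<zeta>) ^ (p - 1)\<close>, hence by \<open>p\<close>. The quotient is rational, so it
  is an ordinary integer, and \<open>p\<close> is prime.\<close>

lemma dvd_if_one_minus_zeta_divides:
  assumes "algebraic_int (of_int a / (1 - \<zeta>))"
  shows "int p dvd a"
proof -
  have "of_int (a ^ (p - 1)) / of_nat p = (of_int a / (1 - \<zeta>)) ^ (p - 1) * ((1 - \<zeta>) ^ (p - 1) / of_nat p)"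
    using one_minus_zeta_nonzero by (simp add: power_divide)
  also have "algebraic_int \<dots>"
    by (intro algebraic_int_mult algebraic_int_power assms p_associated)
  finally have "of_int (a ^ (p - 1)) / of_nat p \<in> (\<int> :: complex set)"
    by (rule rational_algebraic_int_is_int) auto
  then obtain b where "of_int (a ^ (p - 1)) / of_nat p = (of_int b :: complex)" by (elim Ints_cases)
  hence "(of_int (a ^ (p - 1)) :: complex) = of_int (b * int p)"
    using p_gt_1 by (simp add: field_simps)
  hence "a ^ (p - 1) = b * int p" by (simp only: of_int_eq_iff)
  hence "int p dvd a ^ (p - 1)" by simp
  thus ?thesis using prime_dvd_power[of "int p" a "p - 1"] prime_p by simp
qed

text \<open>
  Since \<open>p\<close> is \<open>(1 - \<zeta>)^(p - 1)\<close> up to a unit, the coefficients of the expansion of \<open>p x\<close> in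
  powers of \<open>1 - \<zeta>\<close> are divisible by \<open>1 - \<zeta>\<close>, hence by \<open>p\<close>, one after the other.
\<close>
lemma dvd_coeffs_if_algebraic_int:
  assumes x: "algebraic_int x" and eq: "of_nat p * x = (\<Sum>k<p - 1. of_int (c k) * \<zeta> ^ k)"
    and k: "k < p - 1"
  shows "int p dvd c k"
proof -
  define f where "f = (\<Sum>k<p - 1. Polynomial.monom (c k) k)"
  \<comment> \<open>Substituting 1 - X turns the expansion in powers of \<zeta> into one in powers
    of 1 - \<zeta>. The substitution is an involution, which at the end carries divisibility back
    from \<open>g\<close> to \<open>f\<close>.\<close>
  define g where "g = f \<circ>\<^sub>p [:1, -1:]"
  define b where "b = Polynomial.coeff g"
  define l where "l = 1 - \<zeta>"
  have coeff_f: "Polynomial.coeff f i = (if i < p - 1 then c i else 0)" for i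
    by (simp add: f_def Polynomial.coeff_sum if_distrib cong: if_cong)
  have f_eq: "g \<circ>\<^sub>p [:1, -1:] = f"
  proof -
    have "[:1, -1:] \<circ>\<^sub>p [:1, -1:] = ([:0, 1:] :: int poly)" by (simp add: pcompose_pCons)
    thus ?thesis unfolding g_def Polynomial.pcompose_assoc [symmetric] by simp
  qed
  have "Polynomial.degree f < p - 1"
  proof -
    have "Polynomial.degree f \<le> p - 2"
      by (rule Polynomial.degree_le) (auto simp: coeff_f)
    thus ?thesis using p_gt_1 by linarith
  qed
  hence deg_g: "Polynomial.degree g < p - 1"
    by (simp add: g_def Polynomial.degree_pcompose)
  have l: "l \<noteq> 0" "algebraic_int l"
    using one_minus_zeta_nonzero algebraic_int_zeta by (auto simp: l_def intro: algebraic_int_diff)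
  have "of_nat p * x = poly (map_poly of_int f) \<zeta>"
    unfolding eq by (simp add: f_def of_int_poly_hom.hom_sum poly_sum poly_monom)
  also have "map_poly of_int f = map_poly of_int (g \<circ>\<^sub>p [:1, -1:])"
  proof -
    show ?thesis unfolding f_eq ..
  qed
  also have "poly \<dots> \<zeta> = poly (map_poly of_int g) l"
    by (simp add: of_int_hom.map_poly_pcompose Polynomial.poly_pcompose l_def)
  also have "\<dots> = (\<Sum>i<p - 1. of_int (b i) * l ^ i)"
  proof -
    have "poly (map_poly of_int g) l = (\<Sum>i\<le>Polynomial.degree g. of_int (b i) * l ^ i)"
      by (simp add: poly_altdef b_def)
    also have "\<dots> = (\<Sum>i<p - 1. of_int (b i) * l ^ i)"
      using deg_g by (intro sum.mono_neutral_left) (auto simp: b_def Polynomial.coeff_eq_0)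
    finally show ?thesis .
  qed
  finally have eq': "of_nat p * x = (\<Sum>i<p - 1. of_int (b i) * l ^ i)" .
  have dvd_b: "int p dvd b i" for i
  proof (induction i rule: less_induct)
    case (less i)
    show ?case
    proof (cases "i < p - 1")
      case False
      thus ?thesis using deg_g by (simp add: b_def Polynomial.coeff_eq_0)
    next
      case True
      define d where "d = (\<lambda>j. b j div int p)"
      have d: "b j = int p * d j" if "j < i" for j using less[OF that] by (simp add: d_def)
      \<comment> \<open>\<open>y\<close> removes from \<open>x\<close> the terms already known to be
        divisible by \<open>p\<close>; \<open>r\<close> collects the higher terms divided by
        \<open>l ^ Suc i\<close>.\<close>
      define y where "y = x - (\<Sum>j<i. of_int (d j) * l ^ j)"
      define r where "r = (\<Sum>j\<in>{Suc i..<p - 1}. of_int (b j) * l ^ (j - Suc i))"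
      have split: "sum F {..<p - 1} = sum F {..<i} + (F i + sum F {Suc i..<p - 1})"
        for F :: "nat \<Rightarrow> complex"
        using True sum.atLeastLessThan_concat[of 0 i "p - 1" F]
        by (simp add: atLeast0LessThan sum.atLeast_Suc_lessThan)
      have "of_nat p * x = (\<Sum>j<i. of_int (b j) * l ^ j) + (of_int (b i) * l ^ i
               + (\<Sum>j\<in>{Suc i..<p - 1}. of_int (b j) * l ^ j))"
        unfolding eq' by (rule split)
      also have "(\<Sum>j<i. of_int (b j) * l ^ j) = of_nat p * (\<Sum>j<i. of_int (d j) * l ^ j)"
        by (simp add: d sum_distrib_left mult.assoc)
      also have "(\<Sum>j\<in>{Suc i..<p - 1}. of_int (b j) * l ^ j) = l ^ Suc i * r"
        unfolding r_def sum_distrib_left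
      proof (intro sum.cong refl)
        fix j assume "j \<in> {Suc i..<p - 1}"
        hence "l ^ j = l ^ Suc i * l ^ (j - Suc i)" by (subst power_add [symmetric]) simp
        thus "of_int (b j) * l ^ j = l ^ Suc i * (of_int (b j) * l ^ (j - Suc i))"
          by (simp only: mult_ac)
      qed
      finally have "of_int (b i) * l ^ i = of_nat p * y - l ^ Suc i * r"
        by (simp add: y_def algebra_simps)
      \<comment> \<open>After division by \<open>l ^ Suc i\<close>, extending the fraction by
        \<open>l ^ (p - 1 - Suc i)\<close> produces the unit \<open>p / l ^ (p - 1)\<close> times a
        power of \<open>l\<close>.\<close>
      hence "of_int (b i) / l = of_nat p / (l ^ i * l * l ^ (p - 1 - Suc i)) * (l ^ (p - 1 - Suc i) * y) - r"
        using l(1) by (simp add: divide_simps)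
      also have "l ^ i * l * l ^ (p - 1 - Suc i) = l ^ (i + 1 + (p - 1 - Suc i))"
        by (simp only: power_add power_one_right)
      also have "i + 1 + (p - 1 - Suc i) = p - 1" using True by simp
      also have "algebraic_int (of_nat p / l ^ (p - 1) * (l ^ (p - 1 - Suc i) * y) - r)"
      proof -
        have "algebraic_int y" unfolding y_def
          by (intro algebraic_int_diff algebraic_int_mult algebraic_int_sum algebraic_int_power
                x l(2) algebraic_int_of_int)
        moreover have "algebraic_int r" unfolding r_def
          by (intro algebraic_int_mult algebraic_int_sum algebraic_int_power l(2) algebraic_int_of_int)
        ultimately show ?thesis
          by (intro algebraic_int_diff algebraic_int_mult algebraic_int_power l(2)
                p_associated(1)[folded l_def])
      qed
      finally show ?thesis unfolding l_def by (rule dvd_if_one_minus_zeta_divides)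
    qed
  qed
  hence "[:int p:] dvd g" by (simp add: const_poly_dvd_iff b_def)
  then obtain h where "g = [:int p:] * h" by blast
  hence "f = [:int p:] * (h \<circ>\<^sub>p [:1, -1:])"
    unfolding f_eq [symmetric] by (simp add: pcompose_smult)
  hence "[:int p:] dvd f" by (rule dvdI)
  hence "int p dvd Polynomial.coeff f k" unfolding const_poly_dvd_iff by blast
  thus ?thesis using k by (simp add: coeff_f)
qed

end

section \<open>Automorphisms and integers of the cyclotomic field\<close>

lemma rat_adjoin_incl: "z \<in> rat_adjoin z"
  and rat_adjoin_Rats: "q \<in> \<rat> \<Longrightarrow> q \<in> rat_adjoin z"
  and rat_adjoin_add: "x \<in> rat_adjoin z \<Longrightarrow> y \<in> rat_adjoin z \<Longrightarrow> x + y \<in> rat_adjoin z"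
  and rat_adjoin_mult: "x \<in> rat_adjoin z \<Longrightarrow> y \<in> rat_adjoin z \<Longrightarrow> x * y \<in> rat_adjoin z"
  using generate_field.incl[of _ "insert z \<rat>" class_ring] generate_field.eng_add[of x class_ring _ y]
    generate_field.eng_mult[of x class_ring _ y]
  by (auto simp: rat_adjoin_def)

lemma rat_adjoin_power: "x \<in> rat_adjoin z \<Longrightarrow> x ^ n \<in> rat_adjoin z"
  by (induction n) (auto intro: rat_adjoin_mult rat_adjoin_Rats)

lemma rat_adjoin_sum: "(\<And>i. i \<in> A \<Longrightarrow> f i \<in> rat_adjoin z) \<Longrightarrow> sum f A \<in> rat_adjoin z"
  by (induction A rule: infinite_finite_induct) (auto intro: rat_adjoin_add rat_adjoin_Rats)

lemma rat_adjoin_prod: "(\<And>i. i \<in> A \<Longrightarrow> f i \<in> rat_adjoin z) \<Longrightarrow> prod f A \<in> rat_adjoin z"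
  by (induction A rule: infinite_finite_induct) (auto intro: rat_adjoin_mult rat_adjoin_Rats)

text \<open>The additive-inverse rule of \<open>generate_field\<close> is absorbed as multiplication
  by the rational number -1, so no case for it appears.\<close>

lemma rat_adjoin_induct [consumes 1, case_names gen rat add mult inverse]:
  assumes "x \<in> rat_adjoin z" "P z" "\<And>q. q \<in> \<rat> \<Longrightarrow> P q"
    and "\<And>x y. P x \<Longrightarrow> P y \<Longrightarrow> P (x + y)" and mult: "\<And>x y. P x \<Longrightarrow> P y \<Longrightarrow> P (x * y)"
    and "\<And>x. P x \<Longrightarrow> x \<noteq> 0 \<Longrightarrow> P (inverse x)"
  shows "P x"
  using assms(1) unfolding rat_adjoin_def
proof (induction rule: generate_field.induct)
  case (a_inv h)
  thus ?case using mult[of "- 1" h] assms(3)[of "- 1"] by (simp add: class_ring_simps)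
qed (use assms in \<open>auto simp: class_ring_simps\<close>)

lemma sum_lessThan_shift_mod:
  fixes f :: "nat \<Rightarrow> 'a :: comm_monoid_add"
  assumes "f n = f 0"
  shows "(\<Sum>k<n. f (Suc k)) = (\<Sum>k<n. f k)"
proof (cases n)
  case (Suc m)
  have "(\<Sum>k<n. f (Suc k)) = (\<Sum>k<m. f (Suc k)) + f 0" using assms Suc by simp
  also have "\<dots> = (\<Sum>k<n. f k)" unfolding Suc by (simp only: sum.lessThan_Suc_shift add.commute)
  finally show ?thesis .
qed simp

lemma prod_lessThan_shift_mod:
  fixes f :: "nat \<Rightarrow> 'a :: comm_monoid_mult"
  assumes "f n = f 0"
  shows "(\<Prod>k<n. f (Suc k)) = (\<Prod>k<n. f k)"
proof (cases n)
  case (Suc m)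
  have "(\<Prod>k<n. f (Suc k)) = (\<Prod>k<m. f (Suc k)) * f 0" using assms Suc by simp
  also have "\<dots> = (\<Prod>k<n. f k)" unfolding Suc by (simp only: prod.lessThan_Suc_shift mult.commute)
  finally show ?thesis .
qed simp

text \<open>Separate from the choice of a generator, so that it can also be interpreted for an
  arbitrary element of the Galois group.\<close>

locale adjoin_automorphism =
  fixes \<zeta> :: complex and \<sigma> :: "complex \<Rightarrow> complex"
  assumes automorphism: "\<sigma> \<in> field_automorphisms (rat_adjoin \<zeta>)"
begin

abbreviation L where "L \<equiv> rat_adjoin \<zeta>"

lemma sigma_closed: "x \<in> L \<Longrightarrow> \<sigma> x \<in> L"
  and sigma_add: "x \<in> L \<Longrightarrow> y \<in> L \<Longrightarrow> \<sigma> (x + y) = \<sigma> x + \<sigma> y"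
  and sigma_mult: "x \<in> L \<Longrightarrow> y \<in> L \<Longrightarrow> \<sigma> (x * y) = \<sigma> x * \<sigma> y"
  and sigma_1: "\<sigma> 1 = 1"
  and sigma_inj: "inj_on \<sigma> L"
  using automorphism
  by (auto simp: field_automorphisms_def ring_iso_def Ring.ring_hom_def subring_of_complex_def bij_betw_def)

lemma sigma_0: "\<sigma> 0 = 0"
  using sigma_add[of 0 0] by (simp add: rat_adjoin_Rats)

lemma sigma_of_nat: "\<sigma> (of_nat n) = of_nat n"
  by (induction n) (simp_all add: sigma_0 sigma_add sigma_1 rat_adjoin_Rats)

text \<open>Clearing the denominator and moving the negative part across gives
  \<open>d * q + m = n\<close> with natural numbers \<open>d\<close>, \<open>m\<close>,
  \<open>n\<close>, which \<sigma> fixes.\<close>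

lemma sigma_Rats:
  assumes "q \<in> \<rat>"
  shows "\<sigma> q = q"
proof -
  obtain r where r: "q = of_rat r" using assms by (auto elim: Rats_cases)
  obtain a b where ab: "r = Rat.Fract a b" "b > 0" by (cases r) auto
  obtain n m where nm: "a = int n - int m" by (metis int_diff_cases)
  obtain d where d: "b = int d" "d > 0" using ab(2) by (metis pos_int_cases)
  have q: "of_nat d * q + of_nat m = (of_nat n :: complex)"
    using d ab nm by (simp add: r Fract_of_int_quotient of_rat_divide of_rat_diff)
  have "\<sigma> (of_nat d * q + of_nat m) = of_nat d * \<sigma> q + of_nat m"
    using assms by (simp add: sigma_add sigma_mult sigma_of_nat rat_adjoin_Rats rat_adjoin_mult)
  hence "of_nat d * \<sigma> q + of_nat m = of_nat d * q + of_nat m"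
    unfolding q sigma_of_nat by (rule sym)
  hence "of_nat d * \<sigma> q = of_nat d * q" by (rule add_right_imp_eq)
  thus ?thesis using d(2) by simp
qed

lemma sigma_power: "x \<in> L \<Longrightarrow> \<sigma> (x ^ n) = \<sigma> x ^ n"
  by (induction n) (auto simp: sigma_1 sigma_mult rat_adjoin_power)

lemma sigma_sum: "(\<And>i. i \<in> A \<Longrightarrow> f i \<in> L) \<Longrightarrow> \<sigma> (sum f A) = (\<Sum>i\<in>A. \<sigma> (f i))"
  by (induction A rule: infinite_finite_induct) (auto simp: sigma_0 sigma_add rat_adjoin_sum)

lemma sigma_prod: "(\<And>i. i \<in> A \<Longrightarrow> f i \<in> L) \<Longrightarrow> \<sigma> (prod f A) = (\<Prod>i\<in>A. \<sigma> (f i))"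
  by (induction A rule: infinite_finite_induct) (auto simp: sigma_1 sigma_mult rat_adjoin_prod)

lemma sigma_eq_0_iff: "x \<in> L \<Longrightarrow> \<sigma> x = 0 \<longleftrightarrow> x = 0"
  using inj_onD[OF sigma_inj, of x 0] sigma_0 rat_adjoin_Rats[of 0 \<zeta>] by auto

lemma sigma_poly:
  assumes "\<And>n. Polynomial.coeff q n \<in> \<rat>" "x \<in> L"
  shows "\<sigma> (poly q x) = poly q (\<sigma> x)"
  using assms
  by (simp add: poly_altdef sigma_sum sigma_mult sigma_power sigma_Rats rat_adjoin_Rats
      rat_adjoin_mult rat_adjoin_power)

end

section \<open>Conjugates of \<zeta> indexed by the powers of a generator\<close>

locale cyclotomic_galois =
  prime_root_of_unity p \<zeta> + adjoin_automorphism \<zeta> \<sigma> for p \<zeta> \<sigma> +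
  fixes u :: int
  assumes generates: "generates_units_mod p u"
    and sigma_zeta: "\<sigma> \<zeta> = \<zeta> powi u"
begin

definition v :: nat where "v = nat (u mod int p)"

text \<open>The image of \<zeta> under the \<open>k\<close>-th iterate of \<sigma>, written out as a
  power; it has period \<open>p - 1\<close> in \<open>k\<close>.\<close>

definition c :: "nat \<Rightarrow> complex" where "c k = \<zeta> ^ (v ^ k)"

lemma v_coprime: "coprime v p" and v_powers_surj: "j \<in> {1..<p} \<Longrightarrow> \<exists>k. v ^ k mod p = j"
proof -
  interpret R: residues_prime p "residue_ring (int p)"
    by unfold_locales (use prime_p in auto)
  let ?R = "residue_ring (int p)"
  let ?g = "u mod int p"
  have g: "?g \<in> Units ?R" and gen: "generate (units_of ?R) {?g} = Units ?R"
    using generates by (auto simp: generates_units_mod_def units_of_carrier)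
  interpret U: group "units_of ?R" by (rule R.units_group)
  have units: "Units ?R = {1..int p - 1}" using R.res_prime_units_eq p_gt_1 by (simp add: of_nat_diff)
  have v: "int v = ?g" using p_gt_1 by (simp add: v_def)
  have "0 < v" "v < p" using g units v by auto
  hence "\<not> p dvd v" by (auto dest: dvd_imp_le)
  thus "coprime v p" using prime_imp_coprime[OF prime_p, of v] by (simp add: coprime_commute)
  assume "j \<in> {1..<p}"
  hence "int j \<in> generate (units_of ?R) {?g}" using gen units by auto
  then obtain k :: nat where "int j = ?g [^]\<^bsub>units_of ?R\<^esub> k"
    using U.generate_pow_on_finite_carrier[of ?g] g R.finite_Units by (auto simp: units_of_carrier)
  also have "\<dots> = ?g [^]\<^bsub>?R\<^esub> k" using g by (simp add: R.units_of_pow)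
  also have "\<dots> = u ^ k mod int p" by (rule R.pow_cong)
  also have "\<dots> = int (v ^ k mod p)" using v by (simp add: zmod_int power_mod)
  finally have "j = v ^ k mod p" by (simp only: of_nat_eq_iff)
  thus "\<exists>k. v ^ k mod p = j" by metis
qed

lemma v_power_period: "[v ^ (p - 1) = 1] (mod p)"
  using euler_theorem[of v p] v_coprime prime_p by (simp add: totient_prime coprime_commute)

text \<open>The generator gives surjectivity, once exponents are reduced modulo
  \<open>p - 1\<close>; a surjection between sets of \<open>p - 1\<close> elements is
  injective.\<close>

lemma powers_of_v: "bij_betw (\<lambda>k. v ^ k mod p) {..<p - 1} {1..<p}"
proof -
  have per: "v ^ (k mod (p - 1)) mod p = v ^ k mod p" for k
  proof -
    have "[(v ^ (p - 1)) ^ (k div (p - 1)) * v ^ (k mod (p - 1))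
        = 1 ^ (k div (p - 1)) * v ^ (k mod (p - 1))] (mod p)"
      by (intro cong_mult cong_pow cong_refl v_power_period)
    moreover have "(v ^ (p - 1)) ^ (k div (p - 1)) * v ^ (k mod (p - 1)) = v ^ k"
      by (simp only: power_mult [symmetric] power_add [symmetric] mult_div_mod_eq)
    ultimately show ?thesis by (simp add: cong_def)
  qed
  have "(\<lambda>k. v ^ k mod p) ` {..<p - 1} \<subseteq> {1..<p}"
  proof safe
    fix k
    have "coprime (v ^ k) p" using v_coprime by simp
    hence "\<not> p dvd v ^ k" using p_gt_1 coprime_common_divisor[of "v ^ k" p p] by auto
    hence "v ^ k mod p \<noteq> 0" by (simp add: dvd_eq_mod_eq_0)
    thus "v ^ k mod p \<in> {1..<p}" using p_gt_1 by auto
  qed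
  moreover have "{1..<p} \<subseteq> (\<lambda>k. v ^ k mod p) ` {..<p - 1}"
  proof
    fix j assume "j \<in> {1..<p}"
    then obtain k where "v ^ k mod p = j" using v_powers_surj by blast
    hence "j = v ^ (k mod (p - 1)) mod p" using per by simp
    moreover have "k mod (p - 1) < p - 1" using p_gt_1 by simp
    ultimately show "j \<in> (\<lambda>k. v ^ k mod p) ` {..<p - 1}" by blast
  qed
  ultimately have "(\<lambda>k. v ^ k mod p) ` {..<p - 1} = {1..<p}" by blast
  thus ?thesis by (simp add: bij_betw_def eq_card_imp_inj_on)
qed

lemma c_period: "c (k + (p - 1)) = c k"
proof -
  have "[v ^ k * v ^ (p - 1) = v ^ k * 1] (mod p)" by (intro cong_mult cong_refl v_power_period)
  thus ?thesis by (simp add: c_def zeta_power_eq_iff power_add)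
qed

lemma c_0: "c 0 = \<zeta>" by (simp add: c_def)

lemma c_eq_zeta_power: "c k = \<zeta> ^ (v ^ k mod p)"
  by (simp add: c_def zeta_power_mod)

lemma bij_betw_c: "bij_betw c {..<p - 1} ((\<lambda>j. \<zeta> ^ j) ` {1..<p})"
proof -
  have "inj_on (\<lambda>j. \<zeta> ^ j) {1..<p}" by (rule inj_on_subset[OF inj_zeta_power]) auto
  hence "bij_betw (\<lambda>j. \<zeta> ^ j) {1..<p} ((\<lambda>j. \<zeta> ^ j) ` {1..<p})" by (simp add: bij_betw_def)
  from bij_betw_trans[OF powers_of_v this] show ?thesis
    by (simp add: comp_def c_eq_zeta_power [symmetric])
qed

lemma inj_c: "inj_on c {..<p - 1}"
  using bij_betw_c by (rule bij_betw_imp_inj_on)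

lemma sum_c: "(\<Sum>k<p - 1. f (v ^ k mod p)) = (\<Sum>j\<in>{1..<p}. f j)"
  by (rule sum.reindex_bij_betw[OF powers_of_v])

text \<open>By counting, the powers of \<zeta> are all roots of X^p - 1. This names the roots of
  minimal polynomials and the images of \<zeta> under automorphisms.\<close>

lemma root_of_unity_eq_c:
  assumes "z ^ p = 1" "z \<noteq> 1"
  obtains k where "z = c k"
proof -
  have "card ((\<lambda>j. \<zeta> ^ j) ` {..<p}) = p" by (simp add: card_image inj_zeta_power)
  moreover have "(\<lambda>j. \<zeta> ^ j) ` {..<p} \<subseteq> {w. w ^ p = 1}"
    by (auto simp: power_mult [symmetric] mult.commute[of _ p]) (simp add: power_mult zeta_power_p)
  moreover have "card {w :: complex. w ^ p = 1} = p" using p_gt_1 by (intro card_roots_unity_eq) auto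
  moreover have "finite {w :: complex. w ^ p = 1}" using p_gt_1 by (intro finite_roots_unity) auto
  ultimately have "(\<lambda>j. \<zeta> ^ j) ` {..<p} = {w. w ^ p = 1}" by (intro card_subset_eq) auto
  then obtain j where j: "z = \<zeta> ^ j" "j < p" using assms(1) by blast
  with \<open>z \<noteq> 1\<close> have "j \<noteq> 0" by (metis power_0)
  hence "z \<in> (\<lambda>j. \<zeta> ^ j) ` {1..<p}" using j by auto
  then obtain k where "z = c k" using bij_betw_imp_surj_on[OF bij_betw_c] by blast
  thus ?thesis by (rule that)
qed

lemma c_in_L: "c k \<in> L"
  unfolding c_def by (intro rat_adjoin_power rat_adjoin_incl)

lemma sigma_zeta_v: "\<sigma> \<zeta> = \<zeta> ^ v"
proof -
  have u: "u = int p * (u div int p) + int v" using p_gt_1 by (simp add: v_def)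
  have "\<zeta> powi u = (\<zeta> ^ p) powi (u div int p) * \<zeta> ^ v"
    by (subst u) (simp add: power_int_add power_int_mult zeta_nonzero)
  thus ?thesis by (simp add: sigma_zeta zeta_power_p)
qed

lemma sigma_c: "\<sigma> (c k) = c (Suc k)"
  by (simp add: c_def sigma_power sigma_zeta_v rat_adjoin_incl power_mult [symmetric])

section \<open>Iterates of the automorphism and the trace form\<close>

definition \<tau> :: "nat \<Rightarrow> complex \<Rightarrow> complex" where "\<tau> k = \<sigma> ^^ k"

lemma tau_0: "\<tau> 0 x = x" and tau_Suc: "\<tau> (Suc k) x = \<sigma> (\<tau> k x)"
  by (simp_all add: \<tau>_def)

lemma tau_tau: "\<tau> k (\<tau> l x) = \<tau> (k + l) x"
  by (simp add: \<tau>_def funpow_add)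

lemma tau_closed: "x \<in> L \<Longrightarrow> \<tau> k x \<in> L"
  by (induction k) (simp_all add: tau_0 tau_Suc sigma_closed)

lemma tau_add: "x \<in> L \<Longrightarrow> y \<in> L \<Longrightarrow> \<tau> k (x + y) = \<tau> k x + \<tau> k y"
  by (induction k) (simp_all add: tau_0 tau_Suc sigma_add tau_closed)

lemma tau_mult: "x \<in> L \<Longrightarrow> y \<in> L \<Longrightarrow> \<tau> k (x * y) = \<tau> k x * \<tau> k y"
  by (induction k) (simp_all add: tau_0 tau_Suc sigma_mult tau_closed)

lemma tau_power: "x \<in> L \<Longrightarrow> \<tau> k (x ^ n) = \<tau> k x ^ n"
  by (induction k) (simp_all add: tau_0 tau_Suc sigma_power tau_closed)

lemma tau_Rats: "q \<in> \<rat> \<Longrightarrow> \<tau> k q = q"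
  by (induction k) (simp_all add: tau_0 tau_Suc sigma_Rats)

lemma tau_sum: "(\<And>i. i \<in> A \<Longrightarrow> f i \<in> L) \<Longrightarrow> \<tau> k (sum f A) = (\<Sum>i\<in>A. \<tau> k (f i))"
  by (induction k) (simp_all add: tau_0 tau_Suc sigma_sum tau_closed)

lemma tau_eq_0_iff: "x \<in> L \<Longrightarrow> \<tau> k x = 0 \<longleftrightarrow> x = 0"
  by (induction k) (simp_all add: tau_0 tau_Suc sigma_eq_0_iff tau_closed)

lemma tau_c: "\<tau> k (c l) = c (l + k)"
  by (induction k) (simp_all add: tau_0 tau_Suc sigma_c)

lemma tau_comb:
  assumes "\<And>k. a k \<in> \<rat>"
  shows "\<tau> l (\<Sum>k\<in>A. a k * c k) = (\<Sum>k\<in>A. a k * c (k + l))"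
proof -
  have "a k * c k \<in> L" for k by (intro rat_adjoin_mult rat_adjoin_Rats assms c_in_L)
  thus ?thesis by (simp add: tau_sum tau_mult tau_Rats rat_adjoin_Rats c_in_L assms tau_c)
qed

text \<open>The trace from \<open>L\<close> to the rationals: the \<open>\<tau> k\<close> with
  \<open>k < p - 1\<close> are all automorphisms of \<open>L\<close>.\<close>

definition Tr :: "complex \<Rightarrow> complex" where "Tr x = (\<Sum>k<p - 1. \<tau> k x)"

lemma Tr_Rats: "q \<in> \<rat> \<Longrightarrow> Tr q = of_nat (p - 1) * q"
  by (simp add: Tr_def tau_Rats)

lemma Tr_zeta_power:
  assumes "\<not> p dvd m"
  shows "Tr (\<zeta> ^ m) = - 1"
proof -
  have "Tr (\<zeta> ^ m) = (\<Sum>k<p - 1. c k ^ m)"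
    using tau_c[of _ 0] by (simp add: Tr_def tau_power rat_adjoin_incl c_0)
  also have "\<dots> = (\<Sum>k<p - 1. \<zeta> ^ (m * (v ^ k mod p)))"
    by (simp add: c_eq_zeta_power power_mult [symmetric] mult.commute)
  also have "\<dots> = (\<Sum>j\<in>{1..<p}. \<zeta> ^ (m * j))" by (rule sum_c)
  finally show ?thesis using sum_zeta_powers[OF assms] by simp
qed

lemma Tr_sum_mult:
  assumes "\<And>k. k \<in> A \<Longrightarrow> a k \<in> \<rat>" "\<And>k. k \<in> A \<Longrightarrow> f k \<in> L"
  shows "Tr (\<Sum>k\<in>A. a k * f k) = (\<Sum>k\<in>A. a k * Tr (f k))"
proof -
  have "Tr (\<Sum>k\<in>A. a k * f k) = (\<Sum>i<p - 1. \<Sum>k\<in>A. a k * \<tau> i (f k))"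
    using assms by (simp add: Tr_def tau_sum tau_mult tau_Rats rat_adjoin_Rats rat_adjoin_mult)
  also have "\<dots> = (\<Sum>k\<in>A. a k * Tr (f k))"
    unfolding Tr_def sum_distrib_left by (rule sum.swap)
  finally show ?thesis .
qed

text \<open>The coordinates are read off with the trace form, where \<open>c j ^ (p - 1)\<close> is the inverse of \<open>c j\<close>.\<close>
lemma coeff_eq_Tr:
  assumes a: "\<And>k. a k \<in> \<rat>" and x: "x = (\<Sum>k<p - 1. a k * c k)" and j: "j < p - 1"
  shows "of_nat p * a j = Tr (x * c j ^ (p - 1)) - Tr x"
proof -
  have ndvd: "\<not> p dvd v ^ k" for k
    using v_coprime p_gt_1 coprime_common_divisor[of "v ^ k" p p] by auto
  have "Tr x = (\<Sum>k<p - 1. a k * Tr (c k))"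
    unfolding x by (intro Tr_sum_mult a c_in_L)
  also have "\<dots> = (\<Sum>k<p - 1. - a k)"
    by (intro sum.cong refl) (simp add: c_def Tr_zeta_power[OF ndvd])
  finally have 1: "Tr x = (\<Sum>k<p - 1. - a k)" .
  \<comment> \<open>The product is \<open>c k / c j\<close>: it is 1 for \<open>k = j\<close> and a
    nontrivial power of \<zeta> otherwise, with traces p - 1 and -1. Subtracting \<open>Tr x\<close>
    later cancels the common part -1.\<close>
  have tr: "Tr (c k * c j ^ (p - 1)) = (if k = j then of_nat p else 0) - 1" if "k < p - 1" for k
  proof (cases "k = j")
    case True
    have "c k * c j ^ (p - 1) = c j ^ Suc (p - 1)" unfolding True by simp
    also have "\<dots> = (\<zeta> ^ p) ^ (v ^ j)"
      using p_gt_1 by (simp add: c_def power_mult [symmetric] mult.commute del: power_Suc)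
    also have "\<dots> = 1" by (simp add: zeta_power_p)
    finally have eq: "c k * c j ^ (p - 1) = 1" .
    show ?thesis unfolding eq using True p_gt_1 by (simp add: Tr_Rats of_nat_diff)
  next
    case False
    have eq: "c k * c j ^ (p - 1) = \<zeta> ^ (v ^ k + v ^ j * (p - 1))"
      by (simp add: c_def power_add power_mult)
    have "\<not> p dvd v ^ k + v ^ j * (p - 1)"
    proof
      assume "p dvd v ^ k + v ^ j * (p - 1)"
      hence "\<zeta> ^ (v ^ k + v ^ j * (p - 1)) = 1" by (simp only: zeta_power_eq_1_iff)
      hence "\<zeta> ^ (v ^ k + v ^ j * (p - 1)) * \<zeta> ^ (v ^ j) = \<zeta> ^ (v ^ j)" by simp
      moreover have "v ^ k + v ^ j * (p - 1) + v ^ j = v ^ k + p * v ^ j"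
      proof -
        have "v ^ j * (p - 1) + v ^ j = v ^ j * (p - 1 + 1)" by (simp only: distrib_left mult_1_right)
        thus ?thesis using p_gt_1 by (simp add: mult.commute)
      qed
      ultimately have "\<zeta> ^ (v ^ k + p * v ^ j) = \<zeta> ^ (v ^ j)"
        by (simp only: power_add [symmetric])
      hence "c k = c j" by (simp add: c_def power_add power_mult zeta_power_p)
      with inj_c that j False show False by (auto simp: inj_on_def)
    qed
    from Tr_zeta_power[OF this] show ?thesis using False by (simp only: eq) simp
  qed
  have "Tr (x * c j ^ (p - 1)) = Tr (\<Sum>k<p - 1. a k * (c k * c j ^ (p - 1)))"
    by (simp add: x sum_distrib_right mult.assoc)
  also have "\<dots> = (\<Sum>k<p - 1. a k * Tr (c k * c j ^ (p - 1)))"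
    by (intro Tr_sum_mult a rat_adjoin_mult rat_adjoin_power c_in_L)
  also have "\<dots> = (\<Sum>k<p - 1. (if k = j then a j * of_nat p else 0) + (- a k))"
  proof (intro sum.cong refl)
    fix k assume "k \<in> {..<p - 1}"
    hence "k < p - 1" by simp
    thus "a k * Tr (c k * c j ^ (p - 1)) = (if k = j then a j * of_nat p else 0) + (- a k)"
      unfolding tr[OF \<open>k < p - 1\<close>] by (simp add: algebra_simps)
  qed
  also have "\<dots> = a j * of_nat p + (\<Sum>k<p - 1. - a k)"
    using j by (subst sum.distrib) simp
  finally show ?thesis using 1 by simp
qed

lemma coeffs_unique:
  assumes "\<And>k. a k \<in> \<rat>" "\<And>k. b k \<in> \<rat>"
    and "(\<Sum>k<p - 1. a k * c k) = (\<Sum>k<p - 1. b k * c k)" and "j < p - 1"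
  shows "a j = b j"
proof -
  have "of_nat p * a j = of_nat p * b j"
    using coeff_eq_Tr[of a, OF assms(1) refl assms(4)] coeff_eq_Tr[of b, OF assms(2) refl assms(4)]
    by (simp only: assms(3))
  thus ?thesis using p_gt_1 by simp
qed

section \<open>The rational span of the conjugates\<close>

text \<open>\<open>L_eq_V\<close> shows that this is all of \<open>L\<close>. Periodicity and
  rationality of traces are proved on \<open>V\<close> first, because they use coordinates.\<close>

definition V :: "complex set" where
  "V = {\<Sum>k<p - 1. a k * c k | a. \<forall>k. a k \<in> \<rat>}"

lemma V_subset_L: "V \<subseteq> L"
proof
  fix x assume "x \<in> V"
  then obtain a where x: "x = (\<Sum>k<p - 1. a k * c k)" "\<And>k. a k \<in> \<rat>" unfolding V_def by blast
  show "x \<in> L" unfolding x by (intro rat_adjoin_sum rat_adjoin_mult rat_adjoin_Rats[OF x(2)] c_in_L)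
qed

lemma V_add: "x \<in> V \<Longrightarrow> y \<in> V \<Longrightarrow> x + y \<in> V"
proof -
  assume "x \<in> V" "y \<in> V"
  then obtain a b where "x = (\<Sum>k<p - 1. a k * c k)" "\<And>k. a k \<in> \<rat>"
    and "y = (\<Sum>k<p - 1. b k * c k)" "\<And>k. b k \<in> \<rat>" unfolding V_def by blast
  thus ?thesis unfolding V_def
    by (auto intro!: exI[of _ "\<lambda>k. a k + b k"] simp: sum.distrib distrib_right)
qed

lemma V_scale: "q \<in> \<rat> \<Longrightarrow> x \<in> V \<Longrightarrow> q * x \<in> V"
proof -
  assume q: "q \<in> \<rat>" and "x \<in> V"
  then obtain a where "x = (\<Sum>k<p - 1. a k * c k)" "\<And>k. a k \<in> \<rat>" unfolding V_def by blast
  thus ?thesis using q unfolding V_def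
    by (auto intro!: exI[of _ "\<lambda>k. q * a k"] simp: sum_distrib_left mult.assoc)
qed

lemma V_0: "0 \<in> V"
  unfolding V_def by (auto intro!: exI[of _ "\<lambda>_. 0"])

lemma V_sum: "(\<And>i. i \<in> A \<Longrightarrow> f i \<in> V) \<Longrightarrow> sum f A \<in> V"
  by (induction A rule: infinite_finite_induct) (auto intro: V_add V_0)

lemma V_c: "k < p - 1 \<Longrightarrow> c k \<in> V"
  unfolding V_def
  by (auto intro!: exI[of _ "\<lambda>i. if i = k then 1 else 0"] simp: if_distrib[of "\<lambda>u. u * _"] cong: if_cong)

lemma V_1: "1 \<in> V"
proof -
  have "(\<Sum>k<p - 1. c k) = - 1"
    using sum_c[of "\<lambda>j. \<zeta> ^ j"] sum_zeta_powers[of 1] p_gt_1 by (simp add: c_eq_zeta_power)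
  moreover have "- 1 * (\<Sum>k<p - 1. c k) \<in> V" by (intro V_scale V_sum V_c) auto
  ultimately show ?thesis by simp
qed

lemma V_zeta_power: "\<zeta> ^ m \<in> V"
proof (cases "m mod p = 0")
  case True
  thus ?thesis using V_1 zeta_power_mod[of m] by simp
next
  case False
  hence "m mod p \<in> {1..<p}" using p_gt_1 by simp
  hence "\<zeta> ^ (m mod p) \<in> c ` {..<p - 1}" using bij_betw_imp_surj_on[OF bij_betw_c] by blast
  thus ?thesis using V_c by (auto simp: zeta_power_mod)
qed

lemma V_mult: "x \<in> V \<Longrightarrow> y \<in> V \<Longrightarrow> x * y \<in> V"
proof -
  assume "x \<in> V" "y \<in> V"
  then obtain a b where x: "x = (\<Sum>k<p - 1. a k * c k)" "\<And>k. a k \<in> \<rat>"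
    and y: "y = (\<Sum>k<p - 1. b k * c k)" "\<And>k. b k \<in> \<rat>" unfolding V_def by blast
  have "x * y = (\<Sum>k<p - 1. \<Sum>l<p - 1. (a k * b l) * \<zeta> ^ (v ^ k + v ^ l))"
    unfolding x y sum_product by (simp add: c_def power_add mult_ac)
  also have "\<dots> \<in> V" using x(2) y(2) by (intro V_sum V_scale V_zeta_power Rats_mult)
  finally show ?thesis .
qed

lemma V_prod: "(\<And>i. i \<in> A \<Longrightarrow> f i \<in> V) \<Longrightarrow> prod f A \<in> V"
  by (induction A rule: infinite_finite_induct) (auto intro: V_mult V_1)

lemma V_tau: "x \<in> V \<Longrightarrow> \<tau> l x \<in> V"
proof -
  assume "x \<in> V"
  then obtain a where x: "x = (\<Sum>k<p - 1. a k * c k)" "\<And>k. a k \<in> \<rat>" unfolding V_def by blast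
  have "\<tau> l x = (\<Sum>k<p - 1. a k * \<zeta> ^ (v ^ (k + l)))"
    unfolding x(1) tau_comb[OF x(2)] by (simp add: c_def)
  also have "\<dots> \<in> V" using x(2) by (intro V_sum V_scale V_zeta_power)
  finally show ?thesis .
qed

lemma V_tau_period: "x \<in> V \<Longrightarrow> \<tau> (p - 1) x = x"
proof -
  assume "x \<in> V"
  then obtain a where x: "x = (\<Sum>k<p - 1. a k * c k)" "\<And>k. a k \<in> \<rat>" unfolding V_def by blast
  show ?thesis unfolding x(1) tau_comb[OF x(2)] by (simp only: c_period)
qed

lemma V_Rats: "q \<in> \<rat> \<Longrightarrow> q \<in> V"
  using V_scale[OF _ V_1] by simp

lemma V_Tr: "x \<in> V \<Longrightarrow> Tr x \<in> \<rat>"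
proof -
  assume "x \<in> V"
  then obtain a where x: "x = (\<Sum>k<p - 1. a k * c k)" "\<And>k. a k \<in> \<rat>" unfolding V_def by blast
  have "Tr x = (\<Sum>k<p - 1. a k * Tr (c k))"
    unfolding x by (intro Tr_sum_mult x(2) c_in_L)
  also have "\<dots> = (\<Sum>k<p - 1. - a k)"
  proof (intro sum.cong refl)
    fix k
    have "\<not> p dvd v ^ k" using v_coprime p_gt_1 coprime_common_divisor[of "v ^ k" p p] by auto
    thus "a k * Tr (c k) = - a k" by (simp add: c_def Tr_zeta_power)
  qed
  also have "\<dots> \<in> \<rat>" using x(2) by (intro Rats_sum Rats_minus_iff[THEN iffD2])
  finally show ?thesis .
qed

text \<open>All \<open>p - 1\<close> summands of the trace equal \<open>x\<close>, and the trace is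
  rational.\<close>

lemma V_fixed_Rats:
  assumes "x \<in> V" "\<sigma> x = x"
  shows "x \<in> \<rat>"
proof -
  have "\<tau> k x = x" for k by (induction k) (simp_all add: tau_0 tau_Suc assms)
  hence "Tr x = of_nat (p - 1) * x" by (simp add: Tr_def)
  hence "x = Tr x / of_nat (p - 1)" using p_gt_1 by simp
  also have "\<dots> \<in> \<rat>" using V_Tr[OF assms(1)] by (intro Rats_divide) auto
  finally show ?thesis .
qed

text \<open>The norm of \<open>x\<close> is rational, so the product of the other conjugates is the inverse of \<open>x\<close> up to
  a rational factor.\<close>
lemma V_inverse:
  assumes "x \<in> V" "x \<noteq> 0"
  shows "inverse x \<in> V"
proof -
  have xL: "x \<in> L" using assms V_subset_L by blast
  define n where "n = (\<Prod>k<p - 1. \<tau> k x)"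
  define y where "y = (\<Prod>k<p - 2. \<tau> (Suc k) x)"
  have "p - 1 = Suc (p - 2)" using p_gt_1 by simp
  hence n: "n = x * y" unfolding n_def y_def by (simp only: prod.lessThan_Suc_shift tau_0)
  have y: "y \<in> V" unfolding y_def using assms by (intro V_prod V_tau)
  hence nV: "n \<in> V" unfolding n using assms by (intro V_mult)
  \<comment> \<open>\<sigma> permutes the factors of the norm cyclically, so the norm is fixed and
    therefore rational.\<close>
  have "\<sigma> n = (\<Prod>k<p - 1. \<tau> (Suc k) x)"
    using xL by (simp add: n_def sigma_prod tau_closed tau_Suc)
  also have "\<dots> = n" unfolding n_def
    by (rule prod_lessThan_shift_mod) (simp only: V_tau_period[OF assms(1)] tau_0)
  finally have nQ: "n \<in> \<rat>" using V_fixed_Rats nV by blast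
  have "n \<noteq> 0" using assms xL by (simp add: n_def tau_eq_0_iff)
  hence "inverse x = inverse n * y" using n by (simp add: field_simps)
  thus ?thesis using V_scale[OF _ y] nQ by simp
qed

text \<open>\<open>V\<close> contains \<zeta> and the rationals and is closed under sums, products
  and inverses, so it contains the field they generate.\<close>

lemma L_eq_V: "L = V"
proof
  show "L \<subseteq> V"
  proof
    fix x assume "x \<in> L"
    thus "x \<in> V"
      by (induction rule: rat_adjoin_induct)
        (use V_zeta_power[of 1] in \<open>simp_all add: V_Rats V_add V_mult V_inverse\<close>)
  qed
qed (rule V_subset_L)

lemma L_expand:
  assumes "x \<in> L"
  obtains a where "\<And>k. a k \<in> \<rat>" "x = (\<Sum>k<p - 1. a k * c k)"
  using assms unfolding L_eq_V V_def by blast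

lemma tau_period: "x \<in> L \<Longrightarrow> \<tau> (p - 1) x = x"
  using V_tau_period L_eq_V by simp

lemma L_Tr_Rats: "x \<in> L \<Longrightarrow> Tr x \<in> \<rat>"
  using V_Tr L_eq_V by simp

lemma tau_poly:
  assumes "\<And>i. Polynomial.coeff q i \<in> \<rat>" "x \<in> L"
  shows "\<tau> k (poly q x) = poly q (\<tau> k x)"
  using assms by (induction k) (simp_all add: tau_0 tau_Suc sigma_poly tau_closed)

section \<open>Integrality of the coordinates\<close>

lemma algebraic_int_tau:
  assumes "x \<in> L" "algebraic_int x"
  shows "algebraic_int (\<tau> k x)"
proof -
  from assms(2) obtain q where q: "Polynomial.lead_coeff q = 1" "\<forall>i. Polynomial.coeff q i \<in> \<int>" "poly q x = 0"
    by (auto elim: algebraic_int.cases)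
  have "poly q (\<tau> k x) = \<tau> k (poly q x)"
    using q(2) assms(1) Ints_subset_Rats by (intro tau_poly [symmetric]) auto
  also have "\<dots> = 0" by (simp add: q(3) tau_Rats)
  finally show ?thesis using q by (intro algebraic_int.intros)
qed

lemma Tr_Ints:
  assumes "x \<in> L" "algebraic_int x"
  shows "Tr x \<in> \<int>"
proof (rule rational_algebraic_int_is_int)
  show "algebraic_int (Tr x)" unfolding Tr_def by (intro algebraic_int_sum algebraic_int_tau assms)
  show "Tr x \<in> \<rat>" by (rule L_Tr_Rats[OF assms(1)])
qed

lemma algebraic_int_c: "algebraic_int (c k)"
  unfolding c_def by (intro algebraic_int_power algebraic_int_zeta)

text \<open>The trace formula makes each \<open>p * a k\<close> an integer. Multiplying
  \<open>x\<close> by 1 / \<zeta>, which is \<open>\<zeta> ^ (p - 1)\<close>, moves the exponents 1,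
  ..., p - 1 to 0, ..., p - 2, where \<open>dvd_coeffs_if_algebraic_int\<close> removes the factor
  \<open>p\<close>.\<close>

lemma coeffs_Ints:
  assumes x: "x \<in> L" "algebraic_int x"
    and a: "\<And>k. a k \<in> \<rat>" "x = (\<Sum>k<p - 1. a k * c k)" and j: "j < p - 1"
  shows "a j \<in> \<int>"
proof -
  have "of_nat p * a k \<in> \<int>" if "k < p - 1" for k
    unfolding coeff_eq_Tr[OF a that]
    by (intro Ints_diff Tr_Ints rat_adjoin_mult rat_adjoin_power c_in_L x algebraic_int_mult
        algebraic_int_power algebraic_int_c)
  hence "\<forall>k\<in>{..<p - 1}. \<exists>b. of_nat p * a k = of_int b"
    by (auto elim: Ints_cases)
  from bchoice[OF this] obtain b where b: "\<And>k. k < p - 1 \<Longrightarrow> of_nat p * a k = of_int (b k)" by auto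
  \<comment> \<open>The discrete logarithm to base \<open>v\<close>; it sorts the coefficients by
    exponent of \<zeta> instead of by conjugate.\<close>
  define g where "g = inv_into {..<p - 1} (\<lambda>k. v ^ k mod p)"
  have g: "g (v ^ k mod p) = k" if "k < p - 1" for k
    unfolding g_def using bij_betw_imp_inj_on[OF powers_of_v] that by (intro inv_into_f_f) auto
  have "of_nat p * (x * \<zeta> ^ (p - 1)) = (\<Sum>k<p - 1. of_int (b k) * c k) * \<zeta> ^ (p - 1)"
    unfolding a(2) mult.assoc [symmetric] sum_distrib_left
    by (intro arg_cong[of _ _ "\<lambda>u. u * _"] sum.cong refl) (simp only: b lessThan_iff)
  also have "(\<Sum>k<p - 1. of_int (b k) * c k) = (\<Sum>k<p - 1. of_int (b (g (v ^ k mod p))) * \<zeta> ^ (v ^ k mod p))"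
    by (intro sum.cong refl) (simp add: g c_eq_zeta_power)
  also have "\<dots> = (\<Sum>j\<in>{1..<p}. of_int (b (g j)) * \<zeta> ^ j)" by (rule sum_c)
  also have "\<dots> = (\<Sum>j<p - 1. of_int (b (g (Suc j))) * \<zeta> ^ Suc j)"
    by (rule sum.reindex_bij_witness[of _ Suc "\<lambda>j. j - 1"]) auto
  also have "\<dots> * \<zeta> ^ (p - 1) = (\<Sum>j<p - 1. of_int (b (g (Suc j))) * \<zeta> ^ j)"
  proof -
    have "\<zeta> ^ Suc j * \<zeta> ^ (p - 1) = \<zeta> ^ j" for j
    proof -
      have "\<zeta> ^ Suc j * \<zeta> ^ (p - 1) = \<zeta> ^ (j + p)"
        unfolding power_add [symmetric] using p_gt_1 by simp
      thus ?thesis by (simp add: power_add zeta_power_p)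
    qed
    thus ?thesis by (simp only: sum_distrib_right mult.assoc)
  qed
  finally have eq: "of_nat p * (x * \<zeta> ^ (p - 1)) = (\<Sum>j<p - 1. of_int (b (g (Suc j))) * \<zeta> ^ j)" .
  have dvd: "int p dvd b (g (Suc i))" if "i < p - 1" for i
    using dvd_coeffs_if_algebraic_int[OF _ eq that] x(2)
    by (auto intro: algebraic_int_mult algebraic_int_power algebraic_int_zeta)
  have "v ^ j mod p \<in> {1..<p}" using bij_betwE[OF powers_of_v] j by blast
  hence "int p dvd b (g (v ^ j mod p))" using dvd[of "v ^ j mod p - 1"] by auto
  then obtain d where "b j = int p * d" using g[OF j] by auto
  hence "a j = of_int d" using b[OF j] p_gt_1 by simp
  thus ?thesis by simp
qed

end

section \<open>Subfields and Gaussian periods\<close>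

text \<open>Vieta's formula for the coefficient below the leading one. The factor X from
  \<open>pCons 0\<close> raises its index to \<open>card A\<close>, which also covers the empty
  set.\<close>

lemma coeff_prod_linear_factors:
  fixes A :: "complex set"
  assumes "finite A"
  shows "Polynomial.coeff (pCons 0 (\<Prod>a\<in>A. [:- a, 1:])) (card A) = - (\<Sum>a\<in>A. a)"
  using assms
proof (induction A rule: finite_induct)
  case (insert a A)
  let ?P = "\<Prod>a\<in>A. [:- a, 1:]"
  have "Polynomial.degree ?P = card A" by (simp add: degree_prod_sum_eq)
  moreover have "Polynomial.lead_coeff ?P = 1" by (rule monic_prod) simp
  ultimately have "Polynomial.coeff ?P (card A) = 1" by simp
  thus ?case using insert by (simp add: coeff_pCons split: nat.splits)
qed simp

locale cyclotomic_subfield = cyclotomic_galois +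
  fixes K :: "complex set"
  assumes subfield_K: "subfield K class_ring" and K_subset_L: "K \<subseteq> L"
begin

lemma K_0: "0 \<in> K" and K_1: "1 \<in> K"
  and K_uminus: "x \<in> K \<Longrightarrow> - x \<in> K"
  and K_mult: "x \<in> K \<Longrightarrow> y \<in> K \<Longrightarrow> x * y \<in> K"
  and K_add: "x \<in> K \<Longrightarrow> y \<in> K \<Longrightarrow> x + y \<in> K"
  using subringE[OF subfieldE(1)[OF subfield_K]] by (auto simp: class_ring_simps)

lemma K_inverse: "x \<in> K \<Longrightarrow> inverse x \<in> K"
  using ring.subfield_m_inv(1)[OF class_ring.ring_axioms subfield_K, of x] K_0
  by (cases "x = 0") (auto simp: class_ring_simps)

lemma K_diff: "x \<in> K \<Longrightarrow> y \<in> K \<Longrightarrow> x - y \<in> K"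
  using K_add[of x "- y"] K_uminus[of y] by simp

lemma K_divide: "x \<in> K \<Longrightarrow> y \<in> K \<Longrightarrow> x / y \<in> K"
  by (simp add: divide_inverse K_mult K_inverse)

lemma K_sum: "(\<And>i. i \<in> A \<Longrightarrow> f i \<in> K) \<Longrightarrow> sum f A \<in> K"
  by (induction A rule: infinite_finite_induct) (auto intro: K_add K_0)

lemma K_of_nat: "of_nat n \<in> K"
  by (induction n) (auto intro: K_add K_0 K_1)

lemma K_Rats:
  assumes "q \<in> \<rat>"
  shows "q \<in> K"
proof -
  have "of_int n \<in> K" for n
    by (cases n rule: int_cases2) (auto intro: K_of_nat K_uminus)
  moreover obtain r where r: "q = of_rat r" using assms by (auto elim: Rats_cases)
  ultimately show ?thesis
    by (cases r) (auto simp: Fract_of_int_quotient of_rat_divide intro: K_divide)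
qed

section \<open>The stabiliser of the subfield and the Gaussian periods\<close>

definition fixing :: "nat \<Rightarrow> bool" where "fixing k \<longleftrightarrow> (\<forall>x\<in>K. \<tau> k x = x)"

text \<open>\<open>\<tau> d\<close> generates the stabiliser of \<open>K\<close>, and
  \<open>d\<close> turns out to be the degree of \<open>K\<close> over the rationals.\<close>

definition d :: nat where "d = (LEAST k. 0 < k \<and> fixing k)"

lemma fixing_period: "fixing (p - 1)"
  using tau_period K_subset_L by (auto simp: fixing_def)

lemma d_pos: "d > 0" and fixing_d: "fixing d"
  using LeastI[of "\<lambda>k. 0 < k \<and> fixing k" "p - 1"] fixing_period p_gt_1 by (auto simp: d_def)

lemma fixing_d_mult: "fixing (d * m)"
proof (induction m)
  case 0
  show ?case by (simp add: fixing_def tau_0)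
next
  case (Suc m)
  thus ?case using fixing_d by (simp add: fixing_def tau_tau [symmetric])
qed

text \<open>Division with remainder: if \<open>\<tau> k\<close> fixes \<open>K\<close>, so does
  \<open>\<tau> (k mod d)\<close>, and minimality of \<open>d\<close> forces the remainder to be
  0.\<close>

lemma fixing_iff: "fixing k \<longleftrightarrow> d dvd k"
proof
  assume k: "fixing k"
  have "fixing (k mod d)"
    unfolding fixing_def
  proof
    fix x assume x: "x \<in> K"
    have "\<tau> k x = \<tau> (k mod d + d * (k div d)) x" by simp
    also have "\<dots> = \<tau> (k mod d) x"
      using fixing_d_mult[of "k div d"] x unfolding fixing_def tau_tau [symmetric] by simp
    finally show "\<tau> (k mod d) x = x" using k x by (simp add: fixing_def)
  qed
  moreover have "k mod d < d" using d_pos by simp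
  ultimately have "\<not> 0 < k mod d"
    using not_less_Least[of "k mod d" "\<lambda>k. 0 < k \<and> fixing k"] by (simp add: d_def)
  thus "d dvd k" by auto
qed (use fixing_d_mult in auto)

definition e :: nat where "e = (p - 1) div d"

lemma d_mult_e: "d * e = p - 1"
  using fixing_period by (simp add: fixing_iff e_def)

lemma d_le: "d \<le> p - 1"
  using fixing_period p_gt_1 by (intro dvd_imp_le) (simp_all add: fixing_iff)

text \<open>The Gaussian period of \<open>c i\<close>: the sum over its orbit under
  \<open>\<tau> d\<close>, which has \<open>e\<close> members.\<close>

definition \<eta> :: "nat \<Rightarrow> complex" where "\<eta> i = (\<Sum>j<e. c (i + d * j))"

lemma c_mod: "c (k mod (p - 1)) = c k"
proof -
  have "c (k + (p - 1) * m) = c k" for k m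
    by (induction m) (simp_all add: c_period add.assoc [symmetric] add.commute[of "p - 1"] del: One_nat_def)
  from this[of "k mod (p - 1)" "k div (p - 1)"] show ?thesis by simp
qed

lemma c_shift:
  obtains m where "m < p - 1" "c k = c (i + m)"
proof
  \<comment> \<open>Adding \<open>(p - 1) * i\<close> first keeps the natural-number subtraction
    exact and leaves the residue modulo \<open>p - 1\<close> unchanged.\<close>
  let ?m = "(k + (p - 1) * i - i) mod (p - 1)"
  show "?m < p - 1" using p_gt_1 by simp
  have "1 * i \<le> (p - 1) * i" using p_gt_1 by (intro mult_le_mono1) simp
  hence "i + (k + (p - 1) * i - i) = k + (p - 1) * i" by linarith
  hence "(i + ?m) mod (p - 1) = k mod (p - 1)"
    by (simp only: mod_add_right_eq mod_mult_self2)
  thus "c k = c (i + ?m)" by (metis c_mod)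
qed

lemma inj_c_shift: "inj_on (\<lambda>m. c (i + m)) {..<p - 1}"
proof (rule inj_onI)
  fix m n assume mn: "m \<in> {..<p - 1}" "n \<in> {..<p - 1}" and "c (i + m) = c (i + n)"
  hence "c ((i + m) mod (p - 1)) = c ((i + n) mod (p - 1))" by (simp only: c_mod)
  moreover have "(i + k) mod (p - 1) \<in> {..<p - 1}" for k using p_gt_1 by simp
  ultimately have "(i + m) mod (p - 1) = (i + n) mod (p - 1)"
    using inj_c by (simp only: inj_on_eq_iff)
  hence "[m = n] (mod (p - 1))" by (simp only: cong_def[symmetric] cong_add_lcancel_nat)
  thus "m = n" using mn by (simp add: cong_def)
qed

lemma inj_c_mult: "inj_on (\<lambda>j. c (i + d * j)) {..<e}"
proof (rule inj_onI)
  fix j k assume jk: "j \<in> {..<e}" "k \<in> {..<e}" "c (i + d * j) = c (i + d * k)"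
  have "d * j \<in> {..<p - 1}" "d * k \<in> {..<p - 1}"
    using jk d_pos by (simp_all only: d_mult_e [symmetric] lessThan_iff nat_mult_less_cancel1)
  hence "d * j = d * k" using jk(3) inj_onD[OF inj_c_shift] by blast
  thus "j = k" using d_pos by simp
qed

section \<open>Minimal polynomials over the subfield\<close>

lemma L_poly_c:
  assumes "x \<in> L"
  obtains f where "\<And>n. Polynomial.coeff f n \<in> \<rat>" "x = poly f (c i)"
proof -
  obtain a where a: "\<And>k. a k \<in> \<rat>" "x = (\<Sum>k<p - 1. a k * c k)" using L_expand[OF assms] by blast
  \<comment> \<open>With \<open>b\<close> inverse to \<open>v ^ i\<close> modulo \<open>p\<close>,
    \<zeta> equals \<open>c i ^ b\<close>, so every conjugate is a power of
    \<open>c i\<close>.\<close>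
  obtain b where b: "[v ^ i * b = 1] (mod p)"
    using cong_solve_coprime_nat[of "v ^ i" p] v_coprime by auto
  have c: "c k = c i ^ (b * v ^ k)" for k
  proof -
    have "[v ^ i * b * v ^ k = 1 * v ^ k] (mod p)" by (intro cong_mult b cong_refl)
    thus ?thesis
      by (simp add: c_def power_mult [symmetric] zeta_power_eq_iff mult.assoc cong_sym_eq)
  qed
  define f where "f = (\<Sum>k<p - 1. Polynomial.monom (a k) (b * v ^ k))"
  have "Polynomial.coeff f n \<in> \<rat>" for n
    unfolding f_def Polynomial.coeff_sum using a(1) by (intro Rats_sum) simp
  moreover have "x = poly f (c i)"
    unfolding f_def poly_sum poly_monom a(2) by (intro sum.cong refl) (subst c, rule refl)
  ultimately show ?thesis using that by blast
qed

lemma tau_poly_fixed: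
  assumes "\<And>n. Polynomial.coeff q n \<in> K" "x \<in> L" "fixing k"
  shows "\<tau> k (poly q x) = poly q (\<tau> k x)"
proof -
  have "Polynomial.coeff q n \<in> L" "\<tau> k (Polynomial.coeff q n) = Polynomial.coeff q n" for n
    using assms(1)[of n] assms(3) K_subset_L by (auto simp: fixing_def)
  thus ?thesis using assms(2)
    by (simp add: poly_altdef tau_sum tau_mult tau_power rat_adjoin_mult rat_adjoin_power)
qed

text \<open>\<open>g\<close> has least degree among the nonzero annihilating polynomials. The
  division by \<open>g\<close> cancels one leading term at a time, which shows that the coefficients
  stay in the subset \<open>K\<close>.\<close>

lemma min_poly_exists:
  assumes f: "f \<noteq> 0" "\<And>n. Polynomial.coeff f n \<in> K" "poly f z = 0"
  obtains g where "g \<noteq> 0" "\<And>n. Polynomial.coeff g n \<in> K" "poly g z = 0"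
    "\<And>h. (\<And>n. Polynomial.coeff h n \<in> K) \<Longrightarrow> poly h z = 0 \<Longrightarrow> g dvd h"
proof -
  define Q where "Q = (\<lambda>h. h \<noteq> 0 \<and> (\<forall>n. Polynomial.coeff h n \<in> K) \<and> poly h z = 0)"
  define g where "g = arg_min Polynomial.degree Q"
  have "Q f" using f by (simp add: Q_def)
  hence g: "Q g" and min: "\<And>h. Q h \<Longrightarrow> Polynomial.degree g \<le> Polynomial.degree h"
    using arg_min_nat_lemma[of Q f Polynomial.degree] by (auto simp: g_def)
  have "g dvd h" if "\<forall>n. Polynomial.coeff h n \<in> K" "poly h z = 0" for h
    using that
  proof (induction "Polynomial.degree h" arbitrary: h rule: less_induct)
    case (less h)
    show ?case
    proof (cases "h = 0")
      case False
      define a where "a = Polynomial.lead_coeff h / Polynomial.lead_coeff g"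
      define n where "n = Polynomial.degree h - Polynomial.degree g"
      define w where "w = h - Polynomial.monom a n * g"
      have "Q h" using less.prems False by (simp add: Q_def)
      hence deg: "Polynomial.degree h = n + Polynomial.degree g" using min by (simp add: n_def)
      have a: "a \<in> K" unfolding a_def using less.prems g by (intro K_divide) (auto simp: Q_def)
      have "\<forall>k. Polynomial.coeff w k \<in> K"
        using less.prems g a by (auto simp: w_def Q_def coeff_monom_mult intro!: K_diff K_mult K_0)
      moreover have wz: "poly w z = 0" using less.prems g by (simp add: w_def Q_def)
      moreover have "w = 0 \<or> Polynomial.degree w < Polynomial.degree h"
      proof -
        have "Polynomial.degree w \<le> Polynomial.degree h"
          unfolding w_def using deg Polynomial.degree_mult_le[of "Polynomial.monom a n" g]
            Polynomial.degree_monom_le[of a n]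
          by (intro Polynomial.degree_diff_le) auto
        moreover have "Polynomial.coeff w (Polynomial.degree h) = 0"
          using g by (simp add: w_def coeff_monom_mult deg a_def Q_def)
        ultimately show ?thesis
          by (metis Polynomial.leading_coeff_0_iff le_neq_implies_less)
      qed
      ultimately have "g dvd w" using less.hyps[of w] by auto
      moreover have "h = w + Polynomial.monom a n * g" by (simp add: w_def)
      ultimately show ?thesis by simp
    qed simp
  qed
  thus ?thesis using that[of g] g by (auto simp: Q_def)
qed

text \<open>
  If \<open>c (i + m)\<close> is a root of the minimal polynomial of \<open>c i\<close> over \<open>K\<close>, then \<open>\<tau> m\<close> fixes \<open>K\<close>: write an
  element of \<open>K\<close> as a rational polynomial in \<open>c i\<close>. So \<open>\<eta> i\<close> is the sum of all roots.
\<close>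
lemma eta_in_K: "\<eta> i \<in> K"
proof -
  \<comment> \<open>\<open>F\<close> is X^p - 1, with simple roots, and \<open>G\<close> is
    \<open>F\<close> divided by X - 1. The minimal polynomial \<open>g\<close> of \<open>c i\<close>
    divides both, so its roots are simple and different from 1.\<close>
  define F :: "complex poly" where "F = Polynomial.monom 1 p - 1"
  define G :: "complex poly" where "G = (\<Sum>n<p. Polynomial.monom 1 n)"
  have c_roots: "c k ^ p = 1" "c k \<noteq> 1" for k
  proof -
    show "c k ^ p = 1" by (simp add: c_def power_mult [symmetric] mult.commute[of _ p])
        (simp add: power_mult zeta_power_p)
    have "\<not> p dvd v ^ k" using v_coprime p_gt_1 coprime_common_divisor[of "v ^ k" p p] by auto
    thus "c k \<noteq> 1" by (simp add: c_def zeta_power_eq_1_iff)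
  qed
  have F: "poly F z = z ^ p - 1" for z by (simp add: F_def poly_monom)
  have G: "poly G z = (\<Sum>n<p. z ^ n)" for z by (simp add: G_def poly_sum poly_monom)
  have coeff_F: "Polynomial.coeff F n \<in> K" for n
    unfolding F_def using K_0 K_1 by (auto intro!: K_diff K_uminus)
  have coeff_G: "Polynomial.coeff G n \<in> K" for n
    unfolding G_def Polynomial.coeff_sum using K_0 K_1 by (auto intro!: K_sum)
  have FG: "poly F z = (z - 1) * poly G z" for z unfolding F G by (rule power_diff_1_eq)
  have "F \<noteq> 0"
  proof
    assume "F = 0"
    hence "poly F 0 = 0" by simp
    thus False using p_gt_1 by (simp add: F power_0_left)
  qed
  moreover have rF: "poly F (c i) = 0" by (simp add: F c_roots)
  ultimately obtain g where g: "g \<noteq> 0" "\<And>n. Polynomial.coeff g n \<in> K" "poly g (c i) = 0"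
    and g_dvd: "\<And>h. (\<And>n. Polynomial.coeff h n \<in> K) \<Longrightarrow> poly h (c i) = 0 \<Longrightarrow> g dvd h"
    using min_poly_exists[of F "c i"] coeff_F by blast
  have gF: "g dvd F" by (rule g_dvd) (auto simp: coeff_F rF)
  have gG: "g dvd G" by (rule g_dvd) (use FG[of "c i"] rF c_roots coeff_G in auto)
  have roots: "{z. poly g z = 0} = (\<lambda>j. c (i + d * j)) ` {..<e}"
  proof (intro equalityI subsetI)
    fix z assume "z \<in> (\<lambda>j. c (i + d * j)) ` {..<e}"
    then obtain j where z: "z = \<tau> (d * j) (c i)" by (auto simp: tau_c)
    have "poly g z = \<tau> (d * j) (poly g (c i))"
      unfolding z using g(2) c_in_L fixing_d_mult by (rule tau_poly_fixed [symmetric])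
    thus "z \<in> {z. poly g z = 0}" by (simp add: g(3) tau_Rats)
  next
    fix z assume "z \<in> {z. poly g z = 0}"
    hence z: "poly g z = 0" by simp
    have rG: "poly G z = 0" using gG z by (auto elim: dvdE)
    hence zp: "z ^ p = 1" using FG[of z] F[of z] by simp
    have "z \<noteq> 1"
    proof
      assume "z = 1"
      hence "poly G z = of_nat p" by (simp add: G)
      with rG p_gt_1 show False by simp
    qed
    then obtain k where "z = c k" using root_of_unity_eq_c zp by metis
    then obtain m where m: "m < p - 1" "z = c (i + m)" using c_shift by metis
    have "fixing m"
      unfolding fixing_def
    proof
      fix x assume x: "x \<in> K"
      then obtain f where f: "\<And>n. Polynomial.coeff f n \<in> \<rat>" "x = poly f (c i)"
        using L_poly_c K_subset_L by blast
      have "Polynomial.coeff (f - [:x:]) n \<in> K" for n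
        using x K_Rats[OF f(1)] K_0 by (auto simp: coeff_pCons split: nat.splits intro!: K_diff)
      moreover have "poly (f - [:x:]) (c i) = 0" using f(2) by simp
      ultimately have "g dvd f - [:x:]" by (rule g_dvd)
      then obtain h where "f - [:x:] = g * h" by blast
      hence "poly (f - [:x:]) z = 0" using z by simp
      hence "poly f z = x" by simp
      hence "poly f (\<tau> m (c i)) = x" using m by (simp add: tau_c)
      thus "\<tau> m x = x" using tau_poly[OF f(1) c_in_L, of m i] f(2) by simp
    qed
    then obtain j where j: "m = d * j" by (auto simp: fixing_iff)
    hence "j < e" using m(1) d_mult_e d_pos by (metis nat_mult_less_cancel1)
    thus "z \<in> (\<lambda>j. c (i + d * j)) ` {..<e}" using j m by blast
  qed
  \<comment> \<open>A multiple root of \<open>g\<close> would be one of X^p - 1, whose derivative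
    vanishes only at 0. Hence \<open>g\<close> is a constant times the product over its set of
    roots.\<close>
  have "rsquarefree g"
    unfolding rsquarefree_roots
  proof (intro allI notI)
    fix z assume z: "poly g z = 0 \<and> poly (pderiv g) z = 0"
    obtain h where h: "F = g * h" using gF by blast
    have "poly F z = 0" "poly (pderiv F) z = 0" using z by (simp_all add: h pderiv_mult)
    moreover have "pderiv F = Polynomial.monom (of_nat p) (p - 1)"
      by (simp add: F_def pderiv_diff pderiv_monom)
    ultimately have "z ^ p = 1" "of_nat p * z ^ (p - 1) = 0" by (simp_all add: F poly_monom)
    thus False using p_gt_1 by (auto simp: power_0_left)
  qed
  from complex_poly_decompose_rsquarefree[OF this]
  have eq: "Polynomial.smult (Polynomial.lead_coeff g) (\<Prod>z\<in>{z. poly g z = 0}. [:- z, 1:]) = g" .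
  have fin: "finite {z. poly g z = 0}" by (simp add: roots)
  \<comment> \<open>The coefficient of \<open>g\<close> below the leading one gives the sum of the
    roots, so this sum lies in \<open>K\<close>.\<close>
  have "Polynomial.coeff (pCons 0 g) (card {z. poly g z = 0})
      = Polynomial.lead_coeff g * Polynomial.coeff (pCons 0 (\<Prod>z\<in>{z. poly g z = 0}. [:- z, 1:])) (card {z. poly g z = 0})"
  proof -
    have "pCons 0 g = Polynomial.smult (Polynomial.lead_coeff g) (pCons 0 (\<Prod>z\<in>{z. poly g z = 0}. [:- z, 1:]))"
      by (simp add: eq)
    thus ?thesis by (metis coeff_smult)
  qed
  also have "\<dots> = - Polynomial.lead_coeff g * (\<Sum>z\<in>{z. poly g z = 0}. z)"
    by (simp only: coeff_prod_linear_factors[OF fin]) simp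
  also have "(\<Sum>z\<in>{z. poly g z = 0}. z) = \<eta> i"
    unfolding roots \<eta>_def by (simp add: sum.reindex[OF inj_c_mult])
  finally have "\<eta> i = Polynomial.coeff (pCons 0 g) (card {z. poly g z = 0}) / (- Polynomial.lead_coeff g)"
    using g(1) by (simp add: field_simps)
  also have "\<dots> \<in> K"
    using g(2) K_0 by (intro K_divide K_uminus) (auto simp: coeff_pCons split: nat.splits)
  finally show ?thesis .
qed

section \<open>Periods as a basis of the subfield and of its integers\<close>

text \<open>Cutting the range \<open>k < p - 1\<close> into \<open>e\<close> blocks of length
  \<open>d\<close> matches combinations of periods with coefficients that depend only on the index
  modulo \<open>d\<close>.\<close>

lemma sum_eta: "(\<Sum>i<d. a i * \<eta> i) = (\<Sum>k<p - 1. a (k mod d) * c k)"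
proof -
  have "(\<Sum>k<p - 1. a (k mod d) * c k) = (\<Sum>j<e. \<Sum>k\<in>{j * d..<j * d + d}. a (k mod d) * c k)"
    using sum.nat_group[of "\<lambda>k. a (k mod d) * c k" d e] by (simp add: d_mult_e mult.commute[of e])
  also have "\<dots> = (\<Sum>j<e. \<Sum>i<d. a i * c (i + d * j))"
  proof (rule sum.cong[OF refl])
    fix j
    have "(\<Sum>k\<in>{j * d..<j * d + d}. a (k mod d) * c k) = (\<Sum>i<d. a ((i + j * d) mod d) * c (i + j * d))"
      using sum.shift_bounds_nat_ivl[of "\<lambda>k. a (k mod d) * c k" 0 "j * d" d]
      by (simp add: atLeast0LessThan add.commute)
    thus "(\<Sum>k\<in>{j * d..<j * d + d}. a (k mod d) * c k) = (\<Sum>i<d. a i * c (i + d * j))"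
      by (simp add: mult.commute[of d])
  qed
  also have "\<dots> = (\<Sum>i<d. a i * \<eta> i)"
    unfolding \<eta>_def sum_distrib_left by (rule sum.swap)
  finally show ?thesis by simp
qed

text \<open>A power of \<sigma> that fixes \<open>x\<close> shifts its coordinates cyclically, so by
  uniqueness they have period \<open>d\<close>, and \<open>sum_eta\<close> groups the conjugates
  into periods.\<close>

lemma K_coeffs:
  assumes x: "x \<in> K" and a: "\<And>k. a k \<in> \<rat>" "x = (\<Sum>k<p - 1. a k * c k)"
  shows "x = (\<Sum>i<d. a i * \<eta> i)"
proof -
  \<comment> \<open>Periodic extension, so that shifted indices may run past
    \<open>p - 2\<close>.\<close>
  define b where "b = (\<lambda>k. a (k mod (p - 1)))"
  have b: "b k \<in> \<rat>" "b (k + (p - 1)) = b k" for k by (simp_all add: b_def a)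
  have xb: "x = (\<Sum>k<p - 1. b k * c k)" by (simp add: a(2) b_def)
  have shift: "(\<Sum>k<p - 1. f (k + m)) = (\<Sum>k<p - 1. f k)"
    if "\<And>k. f (k + (p - 1)) = f k" for f :: "nat \<Rightarrow> complex" and m
  proof (induction m)
    case (Suc m)
    have "(\<Sum>k<p - 1. f (Suc k + m)) = (\<Sum>k<p - 1. f (k + m))"
      by (rule sum_lessThan_shift_mod[of "\<lambda>k. f (k + m)"]) (use that[of m] in \<open>simp add: add.commute\<close>)
    thus ?case using Suc by simp
  qed simp
  \<comment> \<open>\<open>\<tau> d'\<close> is the inverse of \<open>\<tau> d\<close> on
    \<open>L\<close>; with it the coefficients are shifted by adding \<open>d\<close> rather than
    subtracting.\<close>
  define d' where "d' = p - 1 - d"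
  have "d dvd d'" unfolding d'_def using d_mult_e by (metis dvd_diff_nat dvd_refl dvd_triv_left)
  hence "fixing d'" by (simp add: fixing_iff)
  hence "x = \<tau> d' x" using x by (simp add: fixing_def)
  also have "\<dots> = (\<Sum>k<p - 1. b k * c (k + d'))" unfolding xb by (rule tau_comb[OF b(1)])
  also have "\<dots> = (\<Sum>k<p - 1. b (k + d' + d) * c (k + d'))"
  proof (intro sum.cong refl)
    fix k
    have "k + d' + d = k + (p - 1)" using d_le by (simp add: d'_def)
    thus "b k * c (k + d') = b (k + d' + d) * c (k + d')" by (simp only: b(2))
  qed
  also have "\<dots> = (\<Sum>k<p - 1. b (k + d) * c k)"
    by (rule shift[of "\<lambda>k. b (k + d) * c k"])
      (simp only: c_period b(2) add.assoc add.commute[of "p - 1" d], simp only: b(2) add.assoc [symmetric])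
  finally have "b (k + d) = b k" if "k < p - 1" for k
    using coeffs_unique[of "\<lambda>k. b (k + d)" b k] b(1) xb that by simp
  hence "b k = b (k - d)" if "k < p - 1" "d \<le> k" for k using that by (metis le_add_diff_inverse2 less_imp_diff_less)
  hence bmod: "b k = b (k mod d)" if "k < p - 1" for k
    using that
  proof (induction k rule: less_induct)
    case (less k)
    show ?case
    proof (cases "d \<le> k")
      case True
      hence "b k = b (k - d)" using less by blast
      also have "\<dots> = b ((k - d) mod d)" using less True d_pos by (intro less.IH) auto
      also have "(k - d) mod d = k mod d" using True by (simp add: le_mod_geq)
      finally show ?thesis .
    qed simp
  qed
  have "x = (\<Sum>k<p - 1. b (k mod d) * c k)"
    unfolding xb by (intro sum.cong refl) (simp add: bmod)
  also have "\<dots> = (\<Sum>i<d. b i * \<eta> i)" by (rule sum_eta [symmetric])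
  also have "\<dots> = (\<Sum>i<d. a i * \<eta> i)" using d_le by (intro sum.cong refl) (simp add: b_def)
  finally show ?thesis .
qed

lemma eta_unique:
  assumes "\<And>i. a i \<in> \<rat>" "\<And>i. b i \<in> \<rat>" "(\<Sum>i<d. a i * \<eta> i) = (\<Sum>i<d. b i * \<eta> i)" "j < d"
  shows "a j = b j"
  using coeffs_unique[of "\<lambda>k. a (k mod d)" "\<lambda>k. b (k mod d)" j] assms d_le by (simp add: sum_eta)

lemma algebraic_int_eta: "algebraic_int (\<eta> i)"
  unfolding \<eta>_def by (intro algebraic_int_sum algebraic_int_c)

text \<open>The coordinates with respect to the periods are the first \<open>d\<close> coordinates
  with respect to the conjugates, which are integers by \<open>coeffs_Ints\<close>.\<close>

lemma algebraic_integers_K: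
  "algebraic_integers K = {\<Sum>i<d. of_int (a i) * \<eta> i | a. True}"
proof (intro equalityI subsetI)
  fix x assume "x \<in> algebraic_integers K"
  hence x: "x \<in> K" "algebraic_int x" by (auto simp: algebraic_integers_def)
  then obtain a where a: "\<And>k. a k \<in> \<rat>" "x = (\<Sum>k<p - 1. a k * c k)"
    using L_expand[of x] K_subset_L by blast
  have "\<forall>k\<in>{..<p - 1}. \<exists>n. a k = of_int n"
  proof
    fix k assume "k \<in> {..<p - 1}"
    hence "a k \<in> \<int>" using coeffs_Ints[OF _ x(2) a] x(1) K_subset_L by blast
    thus "\<exists>n. a k = of_int n" by (elim Ints_cases) blast
  qed
  from bchoice[OF this] obtain n where n: "\<And>k. k < p - 1 \<Longrightarrow> a k = of_int (n k)" by auto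
  have "x = (\<Sum>i<d. a i * \<eta> i)" by (rule K_coeffs[OF x(1) a])
  also have "\<dots> = (\<Sum>i<d. of_int (n i) * \<eta> i)" using d_le by (intro sum.cong refl) (simp add: n)
  finally show "x \<in> {\<Sum>i<d. of_int (a i) * \<eta> i | a. True}" by blast
next
  fix x assume "x \<in> {\<Sum>i<d. of_int (a i) * \<eta> i | a. True}"
  then obtain a where x: "x = (\<Sum>i<d. of_int (a i) * \<eta> i)" by blast
  show "x \<in> algebraic_integers K"
    unfolding x algebraic_integers_def
    by (intro CollectI conjI K_sum K_mult K_Rats Rats_of_int eta_in_K algebraic_int_sum
        algebraic_int_mult algebraic_int_of_int algebraic_int_eta)
qed

end

section \<open>The Galois group, the integral basis and the index\<close>

lemma combine_class_ring:
  fixes Ks Us :: "complex list"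
  shows "ring.combine class_ring Ks Us = (\<Sum>i<min (length Ks) (length Us). Ks ! i * Us ! i)"
proof (induction Ks arbitrary: Us)
  case Nil
  show ?case by (simp add: ring.combine.simps[OF class_ring.ring_axioms] class_ring_simps)
next
  case (Cons k Ks)
  show ?case
  proof (cases Us)
    case Nil
    thus ?thesis by (simp add: ring.combine.simps[OF class_ring.ring_axioms] class_ring_simps)
  next
    case (Cons a as)
    thus ?thesis
      using Cons.IH[of as]
      by (simp add: ring.combine.simps[OF class_ring.ring_axioms] class_ring_simps
          sum.lessThan_Suc_shift del: sum.lessThan_Suc)
  qed
qed

lemma subfield_Rats: "subfield (\<rat> :: complex set) class_ring"
proof (rule field.subfieldI'[OF class_field])
  show "subring (\<rat> :: complex set) class_ring"
    by (rule ring.subringI[OF class_ring.ring_axioms]) (auto simp: class_ring_simps)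
qed (auto simp: class_ring_simps)

context cyclotomic_subfield
begin

lemma dimension_K: "ring.dimension class_ring d \<rat> K"
proof -
  let ?Us = "map \<eta> [0..<d]"
  \<comment> \<open>\<open>combine\<close> stops at the end of the shorter list; padding the
    coefficients with 0 gives a sum of fixed length \<open>d\<close>.\<close>
  have comb: "ring.combine class_ring Ks ?Us = (\<Sum>i<d. (if i < length Ks then Ks ! i else 0) * \<eta> i)" for Ks
  proof -
    have "(\<Sum>i<d. (if i < length Ks then Ks ! i else 0) * \<eta> i)
        = (\<Sum>i<min (length Ks) d. (if i < length Ks then Ks ! i else 0) * \<eta> i)"
      by (rule sum.mono_neutral_right) auto
    also have "\<dots> = ring.combine class_ring Ks ?Us" by (simp add: combine_class_ring)
    finally show ?thesis by simp
  qed
  have "ring.independent class_ring \<rat> ?Us"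
  proof (rule ring.trivial_combine_imp_independent[OF class_ring.ring_axioms subfield_Rats])
    fix Ks :: "complex list"
    assume Ks: "set Ks \<subseteq> \<rat>" "ring.combine class_ring Ks ?Us = \<zero>\<^bsub>class_ring\<^esub>"
    define a where "a = (\<lambda>i. if i < length Ks then Ks ! i else 0)"
    have a: "a i \<in> \<rat>" for i using Ks(1) by (auto simp: a_def)
    have "(\<Sum>i<d. a i * \<eta> i) = (\<Sum>i<d. 0 * \<eta> i)"
      using Ks(2) unfolding comb a_def by (simp add: class_ring_simps)
    hence "a i = 0" if "i < d" for i
      using eta_unique[of a "\<lambda>_. 0" i] a that by simp
    hence "Ks ! i = 0" if "i < length Ks" "i < d" for i using that by (metis a_def)
    thus "set (take (length ?Us) Ks) \<subseteq> {\<zero>\<^bsub>class_ring\<^esub>}"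
      by (auto simp: in_set_conv_nth class_ring_simps)
  qed (simp add: class_ring_simps)
  moreover have "ring.Span class_ring \<rat> ?Us = K"
  proof (intro equalityI subsetI)
    fix x assume "x \<in> ring.Span class_ring \<rat> ?Us"
    then obtain Ks where Ks: "set Ks \<subseteq> \<rat>" "x = ring.combine class_ring Ks ?Us"
      using ring.Span_eq_combine_set[OF class_ring.ring_axioms subfield_Rats, of ?Us]
      by (auto simp: class_ring_simps)
    have "(if i < length Ks then Ks ! i else 0) \<in> \<rat>" for i using Ks(1) by auto
    thus "x \<in> K" unfolding Ks(2) comb by (intro K_sum K_mult K_Rats eta_in_K)
  next
    fix x assume x: "x \<in> K"
    then obtain a where a: "\<And>k. a k \<in> \<rat>" "x = (\<Sum>k<p - 1. a k * c k)"
      using L_expand[of x] K_subset_L by blast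
    have "x = (\<Sum>i<d. a i * \<eta> i)" by (rule K_coeffs[OF x a])
    also have "\<dots> = ring.combine class_ring (map a [0..<d]) ?Us"
      unfolding comb by (intro sum.cong) auto
    finally have "x = ring.combine class_ring (map a [0..<d]) ?Us" .
    moreover have "set (map a [0..<d]) \<subseteq> \<rat>" using a(1) by auto
    moreover have "ring.Span class_ring \<rat> ?Us = {ring.combine class_ring Ks ?Us | Ks. set Ks \<subseteq> \<rat>}"
      by (rule ring.Span_eq_combine_set[OF class_ring.ring_axioms subfield_Rats])
        (simp add: class_ring_simps)
    ultimately show "x \<in> ring.Span class_ring \<rat> ?Us" by blast
  qed
  ultimately show ?thesis
    using ring.dimension_independent[OF class_ring.ring_axioms, of \<rat> ?Us] by simp
qed

section \<open>The Galois group over the subfield and the trace of \<zeta>\<close>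

lemma bij_betw_tau: "bij_betw (\<tau> k) L L"
proof (induction k)
  case 0
  thus ?case by (simp add: \<tau>_def bij_betw_def)
next
  case (Suc k)
  have "bij_betw \<sigma> L L"
    using automorphism by (simp add: field_automorphisms_def ring_iso_def subring_of_complex_def)
  from bij_betw_trans[OF Suc this] show ?case by (simp add: \<tau>_def comp_def)
qed

lemma restrict_tau_automorphism: "restrict (\<tau> k) L \<in> field_automorphisms L"
proof -
  have "bij_betw (restrict (\<tau> k) L) L L"
    using bij_betw_tau by (simp cong: bij_betw_cong)
  thus ?thesis
    by (auto simp: field_automorphisms_def ring_iso_def Ring.ring_hom_def subring_of_complex_def
        tau_closed tau_add tau_mult tau_Rats rat_adjoin_add rat_adjoin_mult rat_adjoin_Rats)
qed

text \<open>An automorphism sends \<zeta> to a nontrivial p-th root of unity, that is to some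
  \<open>\<tau> m \<zeta>\<close>, and equals \<open>\<tau> m\<close> on \<open>L\<close> because
  elements of \<open>L\<close> are rational polynomials in \<zeta>. Fixing \<open>K\<close> then
  means \<open>d dvd m\<close>.\<close>

lemma galois_group_eq: "galois_group L K = (\<lambda>j. restrict (\<tau> (d * j)) L) ` {..<e}"
proof (intro equalityI subsetI)
  fix \<rho> assume "\<rho> \<in> (\<lambda>j. restrict (\<tau> (d * j)) L) ` {..<e}"
  thus "\<rho> \<in> galois_group L K"
    using restrict_tau_automorphism fixing_d_mult K_subset_L by (auto simp: galois_group_def fixing_def)
next
  fix \<rho> assume "\<rho> \<in> galois_group L K"
  hence \<rho>: "\<rho> \<in> field_automorphisms L" "\<rho> \<in> extensional L" "\<And>x. x \<in> K \<Longrightarrow> \<rho> x = x"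
    by (auto simp: galois_group_def)
  interpret R: adjoin_automorphism \<zeta> \<rho> by unfold_locales (rule \<rho>)
  have "\<rho> \<zeta> ^ p = \<rho> (\<zeta> ^ p)" by (rule R.sigma_power [symmetric]) (rule rat_adjoin_incl)
  hence "\<rho> \<zeta> ^ p = 1" by (simp add: zeta_power_p R.sigma_1)
  moreover have "\<rho> \<zeta> \<noteq> 1"
  proof
    assume "\<rho> \<zeta> = 1"
    hence "\<zeta> = 1"
      using inj_onD[OF R.sigma_inj, of \<zeta> 1] by (simp add: R.sigma_1 rat_adjoin_incl rat_adjoin_Rats)
    thus False using one_minus_zeta_nonzero by simp
  qed
  ultimately obtain k where "\<rho> \<zeta> = c k" by (rule root_of_unity_eq_c)
  then obtain m where m: "m < p - 1" "\<rho> \<zeta> = \<tau> m \<zeta>"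
    using c_shift[of k 0] tau_c[of _ 0] by (metis add_0 c_0)
  have eq: "\<rho> x = \<tau> m x" if x: "x \<in> L" for x
  proof -
    obtain f where f: "\<And>n. Polynomial.coeff f n \<in> \<rat>" "x = poly f \<zeta>"
      using L_poly_c[OF x, of 0] c_0 by metis
    show ?thesis
      unfolding f(2) R.sigma_poly[OF f(1) rat_adjoin_incl] tau_poly[OF f(1) rat_adjoin_incl] m(2) ..
  qed
  have "fixing m" using \<rho>(3) eq K_subset_L unfolding fixing_def by (metis subsetD)
  then obtain j where j: "m = d * j" by (auto simp: fixing_iff)
  hence "j < e" using m(1) d_mult_e d_pos by (metis nat_mult_less_cancel1)
  moreover have "\<rho> = restrict (\<tau> (d * j)) L"
  proof (rule extensionalityI[OF \<rho>(2)])
    show "restrict (\<tau> (d * j)) L \<in> extensional L" by simp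
    show "\<rho> x = restrict (\<tau> (d * j)) L x" if "x \<in> L" for x using that eq j by simp
  qed
  ultimately show "\<rho> \<in> (\<lambda>j. restrict (\<tau> (d * j)) L) ` {..<e}" by blast
qed

text \<open>Distinct \<open>j < e\<close> give distinct values at \<zeta>, hence distinct
  automorphisms, so the trace has exactly one summand for each \<open>j\<close>.\<close>

lemma galois_trace_zeta: "galois_trace L K \<zeta> = \<eta> 0"
proof -
  have c: "restrict (\<tau> (d * j)) L \<zeta> = c (0 + d * j)" for j
    using tau_c[of "d * j" 0] by (simp add: rat_adjoin_incl c_0)
  have "inj_on (\<lambda>j. restrict (\<tau> (d * j)) L) {..<e}"
  proof (rule inj_onI)
    fix j k assume "j \<in> {..<e}" "k \<in> {..<e}" "restrict (\<tau> (d * j)) L = restrict (\<tau> (d * k)) L"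
    thus "j = k" using inj_onD[OF inj_c_mult[of 0], of j k] c by metis
  qed
  thus ?thesis
    unfolding galois_trace_def galois_group_eq \<eta>_def by (simp add: sum.reindex c del: restrict_apply)
qed

section \<open>Coordinates with respect to the periods\<close>

lemma theta_eta: "(restrict \<sigma> K ^^ i) (\<eta> 0) = \<eta> i"
proof (induction i)
  case (Suc i)
  have "\<sigma> (\<eta> i) = \<eta> (Suc i)"
    unfolding \<eta>_def by (simp add: sigma_sum c_in_L sigma_c)
  thus ?case using Suc eta_in_K by simp
qed simp

lemma conj_comb_eta: "conj_comb s (restrict \<sigma> K) (\<eta> 0) a = (\<Sum>i<s. of_int (a $ i) * \<eta> i)"
  by (simp add: conj_comb_def theta_eta)

text \<open>This makes \<open>coords\<close>, defined through \<open>the_inv_into\<close>, a genuine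
  inverse.\<close>

lemma bij_betw_conj_comb:
  "bij_betw (conj_comb d (restrict \<sigma> K) (\<eta> 0)) (carrier_vec d) (algebraic_integers K)"
proof (rule bij_betwI')
  fix a b :: "int vec" assume ab: "a \<in> carrier_vec d" "b \<in> carrier_vec d"
  show "conj_comb d (restrict \<sigma> K) (\<eta> 0) a = conj_comb d (restrict \<sigma> K) (\<eta> 0) b \<longleftrightarrow> a = b"
  proof
    assume eq: "conj_comb d (restrict \<sigma> K) (\<eta> 0) a = conj_comb d (restrict \<sigma> K) (\<eta> 0) b"
    show "a = b"
    proof (rule eq_vecI)
      fix i assume "i < dim_vec b"
      hence "i < d" using ab by simp
      thus "a $ i = b $ i"
        using eta_unique[of "\<lambda>i. of_int (a $ i)" "\<lambda>i. of_int (b $ i)" i] eq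
        by (simp add: conj_comb_eta)
    qed (use ab in simp)
  qed simp
next
  fix a :: "int vec"
  show "conj_comb d (restrict \<sigma> K) (\<eta> 0) a \<in> algebraic_integers K"
    unfolding conj_comb_eta algebraic_integers_K by blast
next
  fix x assume "x \<in> algebraic_integers K"
  then obtain a where "x = (\<Sum>i<d. of_int (a i) * \<eta> i)" unfolding algebraic_integers_K by blast
  hence "x = conj_comb d (restrict \<sigma> K) (\<eta> 0) (vec d a)" by (simp add: conj_comb_eta)
  thus "\<exists>a\<in>carrier_vec d. x = conj_comb d (restrict \<sigma> K) (\<eta> 0) a" by (metis vec_carrier)
qed

end

section \<open>The index as a number of values\<close>

lemma card_image_eq_if_same_fibres:
  assumes "\<And>x y. x \<in> A \<Longrightarrow> y \<in> A \<Longrightarrow> f x = f y \<longleftrightarrow> g x = g y"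
  shows "card (f ` A) = card (g ` A)"
proof -
  have "bij_betw (\<lambda>y. g (inv_into A f y)) (f ` A) (g ` A)"
  proof (rule bij_betwI')
    fix y z assume yz: "y \<in> f ` A" "z \<in> f ` A"
    have "g (inv_into A f y) = g (inv_into A f z) \<longleftrightarrow> f (inv_into A f y) = f (inv_into A f z)"
      using assms[OF inv_into_into[OF yz(1)] inv_into_into[OF yz(2)]] by simp
    thus "g (inv_into A f y) = g (inv_into A f z) \<longleftrightarrow> y = z"
      using yz by (simp add: f_inv_into_f)
  next
    fix y assume "y \<in> f ` A"
    thus "g (inv_into A f y) \<in> g ` A" by (intro imageI inv_into_into)
  next
    fix z assume "z \<in> g ` A"
    then obtain x where x: "x \<in> A" "z = g x" by blast
    hence "f (inv_into A f (f x)) = f x" by (intro f_inv_into_f imageI)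
    hence "g (inv_into A f (f x)) = z"
      using assms[of "inv_into A f (f x)" x] x inv_into_into[of "f x" f A] by blast
    thus "\<exists>y\<in>f ` A. z = g (inv_into A f y)" using x by blast
  qed
  thus ?thesis by (rule bij_betw_same_card)
qed

text \<open>The fibres of \<open>F\<close> on \<open>A\<close> are the cosets of \<open>B\<close>,
  so the coset map and \<open>F\<close> have equally many values. The condition on \<open>F\<close>
  also yields that \<open>B\<close> is a subgroup.\<close>

lemma additive_index_eq_card_image:
  assumes A: "0 \<in> A" "\<And>x y. x \<in> A \<Longrightarrow> y \<in> A \<Longrightarrow> x - y \<in> A" and "B \<subseteq> A"
    and F: "\<And>x y. x \<in> A \<Longrightarrow> y \<in> A \<Longrightarrow> F x = F y \<longleftrightarrow> x - y \<in> B"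
  shows "additive_index A B = card (F ` A)"
proof -
  have B: "x - y \<in> B" if "x \<in> B" "y \<in> B" for x y
    using F[of x 0] F[of y 0] F[of x y] that A(1) \<open>B \<subseteq> A\<close> by auto
  have B0: "0 \<in> B" using F[OF A(1) A(1)] by simp
  have "a_rcosets\<^bsub>subring_of_complex A\<^esub> B = (\<lambda>a. (\<lambda>h. h + a) ` B) ` A"
    by (auto simp: A_RCOSETS_def' a_r_coset_def' subring_of_complex_def image_iff)
  moreover have "(\<lambda>h. h + x) ` B = (\<lambda>h. h + y) ` B \<longleftrightarrow> F x = F y" if xy: "x \<in> A" "y \<in> A" for x y
  proof
    assume eq: "(\<lambda>h. h + x) ` B = (\<lambda>h. h + y) ` B"
    have "x \<in> (\<lambda>h. h + x) ` B" using B0 by force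
    then obtain h where "h \<in> B" "x = h + y" unfolding eq by blast
    thus "F x = F y" using F[OF xy] by simp
  next
    have sub: "(\<lambda>h. h + x) ` B \<subseteq> (\<lambda>h. h + y) ` B" if "y - x \<in> B" for x y
    proof
      fix z assume "z \<in> (\<lambda>h. h + x) ` B"
      then obtain h where "h \<in> B" "z = h + x" by blast
      hence "h - (y - x) \<in> B" "z = (h - (y - x)) + y" using B that by auto
      thus "z \<in> (\<lambda>h. h + y) ` B" by blast
    qed
    assume "F x = F y"
    hence "x - y \<in> B" "y - x \<in> B" using F[OF xy] F[OF xy(2,1)] by auto
    thus "(\<lambda>h. h + x) ` B = (\<lambda>h. h + y) ` B" using sub by blast
  qed
  ultimately show ?thesis
    unfolding additive_index_def by (simp only:) (rule card_image_eq_if_same_fibres)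
qed

section \<open>The Fourier matrix modulo p\<close>

text \<open>\<beta> has order \<open>p - 1 = q * s\<close> modulo \<open>p\<close>, so its
  \<open>q\<close>-th power has order \<open>s\<close>.\<close>

lemma cong_power_quotient_iff:
  assumes p: "Factorial_Ring.prime p" and s: "s > 0" "s dvd p - 1"
    and root: "residue_primroot p (nat (\<beta> mod int p))"
  shows "[(\<beta> ^ ((p - 1) div s)) ^ n = 1] (mod int p) \<longleftrightarrow> s dvd n"
proof -
  define b where "b = nat (\<beta> mod int p)"
  define q where "q = (p - 1) div s"
  have p1: "p > 1" using p prime_gt_1_nat by blast
  have q: "p - 1 = q * s" using s by (simp add: q_def)
  hence "q > 0" using p1 by (cases "q = 0") auto
  have b: "int b = \<beta> mod int p" using p1 by (simp add: b_def)
  have "[(\<beta> ^ q) ^ n = 1] (mod int p) \<longleftrightarrow> [int b ^ (q * n) = 1] (mod int p)"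
    by (simp add: cong_def power_mult [symmetric] b power_mod)
  also have "\<dots> \<longleftrightarrow> [b ^ (q * n) = 1] (mod p)"
    by (metis cong_int_iff of_nat_1 of_nat_power)
  also have "\<dots> \<longleftrightarrow> q * s dvd q * n"
    using root p q by (simp add: ord_divides' b_def residue_primroot_def totient_prime)
  also have "\<dots> \<longleftrightarrow> s dvd n" using \<open>q > 0\<close> by simp
  finally show ?thesis by (simp add: q_def)
qed

lemma cong_sum_powers_0:
  fixes x :: int
  assumes "Factorial_Ring.prime p" "[x ^ s = 1] (mod int p)" "\<not> [x = 1] (mod int p)"
  shows "[(\<Sum>j<s. x ^ j) = 0] (mod int p)"
proof -
  have "(x - 1) * (\<Sum>j<s. x ^ j) = x ^ s - 1" by (rule power_diff_1_eq [symmetric])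
  hence "int p dvd (x - 1) * (\<Sum>j<s. x ^ j)" using assms(2) by (simp add: cong_iff_dvd_diff)
  moreover have "\<not> int p dvd x - 1" using assms(3) by (simp add: cong_iff_dvd_diff)
  ultimately have "int p dvd (\<Sum>j<s. x ^ j)"
    using prime_dvd_mult_iff[of "int p"] assms(1) by simp
  thus ?thesis by (simp add: cong_0_iff)
qed

text \<open>
  The system is solved by the inverse discrete Fourier transform modulo \<open>p\<close>, where \<open>- ((p - 1) / s)\<close>
  is the inverse of \<open>s\<close> and \<open>\<alpha> ^ (s - l)\<close> that of \<open>\<alpha> ^ l\<close>.
\<close>
lemma mu_system_solvable:
  assumes p: "Factorial_Ring.prime p" and s: "s > 0" "s dvd p - 1"
    and root: "residue_primroot p (nat (\<beta> mod int p))" and \<alpha>: "\<alpha> = \<beta> ^ ((p - 1) div s)"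
    and m: "m \<le> s"
  obtains a where "a \<in> carrier_vec s" "\<And>i. i < m \<Longrightarrow> [a \<bullet> mu s \<alpha> i = b i] (mod int p)"
proof -
  define q where "q = (p - 1) div s"
  have p1: "p > 1" using p prime_gt_1_nat by blast
  have q: "p - 1 = q * s" using s p1 by (auto simp: q_def elim: dvdE)
  have \<alpha>_iff: "[\<alpha> ^ n = 1] (mod int p) \<longleftrightarrow> s dvd n" for n
    unfolding \<alpha> by (rule cong_power_quotient_iff[OF p s root])
  \<comment> \<open>The inverse transform, with right-hand side 0 for the rows from \<open>m\<close>
    to \<open>s - 1\<close>.\<close>
  define a where "a = vec s (\<lambda>j. - int q * (\<Sum>l<m. b l * \<alpha> ^ ((s - l) * j)))"
  have "[a \<bullet> mu s \<alpha> i = b i] (mod int p)" if i: "i < m" for i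
  proof -
    \<comment> \<open>Orthogonality of the rows, with \<open>s - l + i\<close> in place of
      \<open>i - l\<close> to stay in the natural numbers; as \<open>l\<close> and \<open>i\<close>
      are below \<open>s\<close>, it is a multiple of \<open>s\<close> only for
      \<open>l = i\<close>.\<close>
    have G: "[(\<Sum>j<s. \<alpha> ^ ((s - l + i) * j)) = (if l = i then int s else 0)] (mod int p)" if l: "l < m" for l
    proof (cases "l = i")
      case True
      have "[(\<Sum>j<s. \<alpha> ^ (s * j)) = (\<Sum>j<s. 1)] (mod int p)"
        by (intro cong_sum) (simp add: \<alpha>_iff)
      thus ?thesis using True i m by simp
    next
      case False
      have "\<not> s dvd s - l + i"
      proof
        assume dvd: "s dvd s - l + i"
        show False
        proof (cases "l < i")
          case True
          hence "s - l + i = s + (i - l)" using l m by simp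
          hence "s dvd i - l" using dvd by simp
          hence "s \<le> i - l" using True by (intro dvd_imp_le) simp_all
          thus False using i m by simp
        next
          case False
          hence "s - l + i < s" "0 < s - l + i" using \<open>l \<noteq> i\<close> l m by auto
          thus False using dvd by (auto dest: dvd_imp_le)
        qed
      qed
      hence "[(\<Sum>j<s. (\<alpha> ^ (s - l + i)) ^ j) = 0] (mod int p)"
        by (intro cong_sum_powers_0[OF p]) (simp_all only: power_mult [symmetric] \<alpha>_iff dvd_triv_right not_False_eq_True)
      thus ?thesis using False by (simp add: power_mult)
    qed
    have "a \<bullet> mu s \<alpha> i = (\<Sum>j<s. (- int q * (\<Sum>l<m. b l * \<alpha> ^ ((s - l) * j))) * \<alpha> ^ (j * i))"
      by (simp add: scalar_prod_def a_def mu_def atLeast0LessThan)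
    also have "\<dots> = (\<Sum>j<s. \<Sum>l<m. - int q * b l * \<alpha> ^ ((s - l + i) * j))"
      unfolding sum_distrib_left sum_distrib_right
      by (intro sum.cong refl) (simp add: power_add distrib_right mult.commute[of i])
    also have "\<dots> = (\<Sum>l<m. - int q * b l * (\<Sum>j<s. \<alpha> ^ ((s - l + i) * j)))"
      unfolding sum_distrib_left by (rule sum.swap)
    also have "[\<dots> = (\<Sum>l<m. - int q * b l * (if l = i then int s else 0))] (mod int p)"
      by (intro cong_sum cong_mult cong_refl G) simp
    also have "(\<Sum>l<m. - int q * b l * (if l = i then int s else 0)) = - int (q * s) * b i"
      using i by (simp add: if_distrib cong: if_cong)
    \<comment> \<open>Since \<open>q * s = p - 1\<close>, the factor is 1 - p, which is 1 modulo
      \<open>p\<close>.\<close>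
    also have "\<dots> = b i - int p * b i"
      using p1 by (simp only: q [symmetric]) (simp add: of_nat_diff algebra_simps)
    also have "[\<dots> = b i] (mod int p)" by (simp add: cong_iff_dvd_diff)
    finally show ?thesis .
  qed
  thus ?thesis using that[of a] by (simp add: a_def)
qed

section \<open>The index of the lattice\<close>

context cyclotomic_subfield
begin

text \<open>\<open>F\<close> records the products with the first \<open>m\<close> rows modulo
  \<open>p\<close>. Its fibres are the cosets of the lattice, and by
  \<open>mu_system_solvable\<close> all \<open>p ^ m\<close> values occur.\<close>

lemma index_M_lattice:
  assumes root: "residue_primroot p (nat (\<beta> mod int p))"
    and \<alpha>: "\<alpha> = \<beta> ^ ((p - 1) div d)"
  shows "additive_index (algebraic_integers K) (M_lattice p d K (restrict \<sigma> K) (\<eta> 0) \<alpha>)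
    = p ^ Suc (if odd d then (d - 1) div 2 else d div 2)"
proof -
  \<comment> \<open>The indices start at 0, so the number of conditions is the upper bound plus one.
    It is at most \<open>d\<close>; for even \<open>d\<close> this uses
    \<open>d \<ge> 2\<close>.\<close>
  define m where "m = Suc (if odd d then (d - 1) div 2 else d div 2)"
  have m: "m \<le> d"
  proof (cases "odd d")
    case False
    hence "d \<ge> 2" using d_pos by (cases "d = 1") auto
    thus ?thesis using False by (auto simp: m_def)
  qed (use d_pos in \<open>auto simp: m_def\<close>)
  define C where "C = conj_comb d (restrict \<sigma> K) (\<eta> 0)"
  define X' where "X' = coords d (restrict \<sigma> K) (\<eta> 0)"
  note bij = bij_betw_conj_comb[folded C_def]
  have X'C: "X' (C a) = a" if "a \<in> carrier_vec d" for a
    using that bij unfolding X'_def coords_def C_def[symmetric]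
    by (intro the_inv_into_f_f bij_betw_imp_inj_on)
  have C_diff: "C (a - b) = C a - C b" if "a \<in> carrier_vec d" "b \<in> carrier_vec d" for a b
    using that unfolding C_def conj_comb_eta
    by (simp add: sum_subtractf [symmetric] left_diff_distrib)
  have surj: "\<exists>a\<in>carrier_vec d. x = C a" if "x \<in> algebraic_integers K" for x
    using that bij_betw_imp_surj_on[OF bij] by blast
  have C_int: "C a \<in> algebraic_integers K" if "a \<in> carrier_vec d" for a
    using that bij_betw_imp_surj_on[OF bij] by blast
  \<comment> \<open>\<open>restrict\<close> makes the values extensional functions on
    \<open>{..<m}\<close>, which \<open>card_PiE\<close> counts.\<close>
  define F where "F = (\<lambda>x. restrict (\<lambda>i. (X' x \<bullet> mu d \<alpha> i) mod int p) {..<m})"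
  have range: "{0..(if odd d then (d - 1) div 2 else d div 2)} = {..<m}"
    by (auto simp: m_def)
  have M: "M_lattice p d K (restrict \<sigma> K) (\<eta> 0) \<alpha>
    = {x \<in> algebraic_integers K. \<forall>i\<in>{..<m}. [X' x \<bullet> mu d \<alpha> i = 0] (mod int p)}"
    unfolding M_lattice_def range X'_def ..
  have "additive_index (algebraic_integers K) (M_lattice p d K (restrict \<sigma> K) (\<eta> 0) \<alpha>)
    = card (F ` algebraic_integers K)"
  proof (rule additive_index_eq_card_image)
    show "0 \<in> algebraic_integers K" using K_0 by (simp add: algebraic_integers_def)
    show "x - y \<in> algebraic_integers K" if "x \<in> algebraic_integers K" "y \<in> algebraic_integers K" for x y
      using that by (simp add: algebraic_integers_def K_diff algebraic_int_diff)
    show "M_lattice p d K (restrict \<sigma> K) (\<eta> 0) \<alpha> \<subseteq> algebraic_integers K"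
      by (auto simp: M_lattice_def)
    fix x y assume xy: "x \<in> algebraic_integers K" "y \<in> algebraic_integers K"
    then obtain a b where a: "a \<in> carrier_vec d" "x = C a" and b: "b \<in> carrier_vec d" "y = C b"
      using surj by metis
    have ab: "a - b \<in> carrier_vec d" "x - y = C (a - b)" using a b by (simp_all add: C_diff)
    have mu: "mu d \<alpha> i \<in> carrier_vec d" for i by (simp add: mu_def)
    have "F x = F y \<longleftrightarrow> (\<forall>i\<in>{..<m}. (a \<bullet> mu d \<alpha> i) mod int p = (b \<bullet> mu d \<alpha> i) mod int p)"
      using a b by (auto simp: F_def X'C restrict_def fun_eq_iff)
    also have "\<dots> \<longleftrightarrow> (\<forall>i\<in>{..<m}. [(a - b) \<bullet> mu d \<alpha> i = 0] (mod int p))"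
      using a b mu
      by (simp add: minus_scalar_prod_distrib[of _ d] cong_def[symmetric] cong_iff_dvd_diff cong_0_iff)
    also have "\<dots> \<longleftrightarrow> x - y \<in> M_lattice p d K (restrict \<sigma> K) (\<eta> 0) \<alpha>"
      unfolding M ab(2) using C_int[OF ab(1)] by (simp add: X'C[OF ab(1)])
    finally show "F x = F y \<longleftrightarrow> x - y \<in> M_lattice p d K (restrict \<sigma> K) (\<eta> 0) \<alpha>" .
  qed
  also have "F ` algebraic_integers K = ({..<m} \<rightarrow>\<^sub>E {0..<int p})"
  proof (intro equalityI subsetI)
    fix f assume "f \<in> F ` algebraic_integers K"
    thus "f \<in> ({..<m} \<rightarrow>\<^sub>E {0..<int p})" using p_gt_1 by (auto simp: F_def)
  next
    fix f assume f: "f \<in> ({..<m} \<rightarrow>\<^sub>E {0..<int p})"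
    obtain a where a: "a \<in> carrier_vec d" "\<And>i. i < m \<Longrightarrow> [a \<bullet> mu d \<alpha> i = f i] (mod int p)"
      using mu_system_solvable[OF prime_p d_pos dvdI[OF d_mult_e [symmetric]] root \<alpha> m] by metis
    have "F (C a) = f"
    proof (rule extensionalityI)
      show "F (C a) \<in> extensional {..<m}" by (simp add: F_def)
      show "f \<in> extensional {..<m}" using f by (simp add: PiE_def)
      fix i assume i: "i \<in> {..<m}"
      hence "f i \<in> {0..<int p}" using f by (rule PiE_mem[rotated])
      thus "F (C a) i = f i" using a(2)[of i] i by (simp add: F_def X'C[OF a(1)] cong_def)
    qed
    thus "f \<in> F ` algebraic_integers K" using C_int[OF a(1)] by blast
  qed
  also have "card \<dots> = p ^ m" by (simp add: card_PiE)
  finally show ?thesis by (simp only: m_def)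
qed

end

theorem theorem17:
  fixes p s :: nat
    and \<zeta> t :: complex
    and L K :: "complex set"
    and u \<alpha> \<beta> :: int
    and \<sigma> \<theta> :: "complex \<Rightarrow> complex"
  assumes "Factorial_Ring.prime p"
    and "s > 0" and "s dvd p - 1"
    and "primitive_root_of_unity p \<zeta>"
    and "L = rat_adjoin \<zeta>"
    and "subfield K class_ring" and "K \<subseteq> L"
    and "ring.dimension class_ring s \<rat> K"
    and "generates_units_mod p u"
    and "\<sigma> \<in> field_automorphisms L" and "\<sigma> \<zeta> = \<zeta> powi u"
    and "\<theta> = restrict \<sigma> K"
    and "t = galois_trace L K \<zeta>"
    and "residue_primroot p (nat (\<beta> mod int p))"
    and "\<alpha> = \<beta> ^ ((p - 1) div s)"
  shows "additive_index (algebraic_integers K) (M_lattice p s K \<theta> t \<alpha>)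
           = (if odd s then p ^ ((s + 1) div 2) else p ^ ((s + 2) div 2))"
proof -
  interpret cyclotomic_subfield p \<zeta> \<sigma> u K
    by (intro cyclotomic_subfield.intro cyclotomic_galois.intro prime_root_of_unity.intro
        adjoin_automorphism.intro cyclotomic_galois_axioms.intro cyclotomic_subfield_axioms.intro)
      (use assms in simp_all)
  \<comment> \<open>Both numbers are the dimension of \<open>K\<close> over the rationals.\<close>
  have s: "s = d"
    by (rule ring.dimension_is_inj[OF class_ring.ring_axioms subfield_Rats assms(8) dimension_K])
  have "additive_index (algebraic_integers K) (M_lattice p s K \<theta> t \<alpha>)
      = p ^ Suc (if odd s then (s - 1) div 2 else s div 2)"
    using index_M_lattice[of \<beta> \<alpha>] assms(14,15) galois_trace_zeta
    unfolding assms(5,12,13) s by (simp only:)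
  also have "\<dots> = (if odd s then p ^ ((s + 1) div 2) else p ^ ((s + 2) div 2))"
    by (auto elim!: oddE)
  finally show ?thesis .
qed

end
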